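(* Let $\beta>1$ and $0<\zeta/\alpha<2$. For an integer $k\ge 0$ let $N_k$ denote the number of vertices of degree $k$ in $\mathcal{G}(N;\zeta,\alpha,\beta)$. Then for every fixed integer $k\ge0$, $$\frac{N_k}{N}\xrightarrow{p}\Pr[\mathsf{MP}(F)=k]\quad\text{as }N\to\infty,$$ where $\mathsf{MP}(F)$ is a mixed Poisson random variable with mixing distribution $F(t)=1-(K/t)^{2\alpha/\zeta}$ for $t\ge K$ and $F(t)=0$ for $t<K$, with $K=\frac{4\alpha}{2\alpha-\zeta}\cdot\frac{1}{\beta}\cdot\frac{1}{\sin(\pi/\beta)}$.
   Context: Model $\mathcal{G}(N;\zeta,\alpha,\beta)$: fix $0<\zeta<2$, $\alpha>0$, $\beta>0$. For a positive integer $N$ let $R$ be defined by $N=e^{\zeta R/2}$. Work in the native representation of the hyperbolic plane of curvature $-\zeta^2$: points of $\mathbb{R}^2$ in polar coordinates $(r,\theta)$, where $r$ is the hyperbolic distance from the origin, and the hyperbolic distance $d(u,v)$ between $u=(r_u,\theta_u)$ and $v=(r_v,\theta_v)$ is given by $\cosh(\zeta d(u,v))=\cosh(\zeta r_u)\cosh(\zeta r_v)-\sinh(\zeta r_u)\sinh(\zeta r_v)\cos(\theta_{u,v})$, with $\theta_{u,v}\in[0,\pi]$ the relative angle. The vertex set consists of $N$ independent random points in the disc $\mathcal{D}_R$ of radius $R$ about the origin, each with angle uniform on $(0,2\pi]$ and, independently, radius with density $\rho(r)=\alpha\frac{\sinh(\alpha r)}{\cosh(\alpha R)-1}$ on $[0,R]$.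 Given the positions, each pair of distinct vertices $u,v$ is joined independently with probability $p_{u,v}=\frac{1}{\exp\left(\beta\frac{\zeta}{2}(d(u,v)-R)\right)+1}$. A mixed Poisson variable satisfies $\Pr[\mathsf{MP}(F)=k]=\int e^{-t}\frac{t^k}{k!}\,dF(t)$. *)

theory Defs
  imports "HOL-Probability.Probability"
begin

text \<open>
  A point is its pair of polar coordinates \<open>(r, \<theta>)\<close> with \<open>r \<in> [0, R]\<close> and \<open>\<theta> \<in> (0, 2\<pi>]\<close>.
  The parameters \<open>\<zeta>\<close>, \<open>\<alpha>\<close>, \<open>\<beta>\<close> are explicit arguments of the definitions.
\<close>

text \<open>The solution \<open>R\<close> of \<open>N = exp (\<zeta> R / 2)\<close>.\<close>

definition disc_radius :: "real \<Rightarrow> nat \<Rightarrow> real" where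
  "disc_radius \<zeta> N = 2 / \<zeta> * ln (real N)"

text \<open>The angle in \<open>[0, \<pi>]\<close> between two directions given by angles in \<open>(0, 2\<pi>]\<close>.\<close>

definition relative_angle :: "real \<Rightarrow> real \<Rightarrow> real" where
  "relative_angle \<theta>1 \<theta>2 = min \<bar>\<theta>1 - \<theta>2\<bar> (2 * pi - \<bar>\<theta>1 - \<theta>2\<bar>)"

text \<open>
  The nonnegative solution \<open>d\<close> of the hyperbolic law of cosines in curvature \<open>- \<zeta>\<^sup>2\<close>;
  see \<open>cosh_hyp_dist\<close> and \<open>hyp_dist_nonneg\<close> below.
\<close>

definition hyp_dist :: "real \<Rightarrow> real \<times> real \<Rightarrow> real \<times> real \<Rightarrow> real" where
  "hyp_dist \<zeta> u v =
     arcosh (cosh (\<zeta> * fst u) * cosh (\<zeta> * fst v)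
       - sinh (\<zeta> * fst u) * sinh (\<zeta> * fst v) * cos (relative_angle (snd u) (snd v))) / \<zeta>"

text \<open>For \<open>N = 1\<close> we have \<open>R = 0\<close>, the denominator vanishes and the density is identically 0.\<close>

definition radial_density :: "real \<Rightarrow> real \<Rightarrow> real \<Rightarrow> real" where
  "radial_density \<alpha> R r =
     (if r \<in> {0..R} then \<alpha> * sinh (\<alpha> * r) / (cosh (\<alpha> * R) - 1) else 0)"

definition point_distribution :: "real \<Rightarrow> real \<Rightarrow> (real \<times> real) measure" where
  "point_distribution \<alpha> R =
     density lborel (\<lambda>r. ennreal (radial_density \<alpha> R r)) \<Otimes>\<^sub>M uniform_measure lborel {0<..2 * pi}"

definition positions :: "real \<Rightarrow> real \<Rightarrow> nat \<Rightarrow> (nat \<Rightarrow> real \<times> real) measure" where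
  "positions \<zeta> \<alpha> N = (\<Pi>\<^sub>M i\<in>{..<N}. point_distribution \<alpha> (disc_radius \<zeta> N))"

definition connection_prob :: "real \<Rightarrow> real \<Rightarrow> real \<Rightarrow> real \<times> real \<Rightarrow> real \<times> real \<Rightarrow> real" where
  "connection_prob \<zeta> \<beta> R u v = 1 / (exp (\<beta> * (\<zeta> / 2) * (hyp_dist \<zeta> u v - R)) + 1)"

text \<open>
  A graph on the vertex set \<open>{..<N}\<close> is encoded by the indicator function of its edges,
  the edge between \<open>u < v\<close> being represented by the pair \<open>(u, v)\<close>.
\<close>

type_synonym edges = "nat \<times> nat \<Rightarrow> bool"

definition adjacent :: "edges \<Rightarrow> nat \<Rightarrow> nat \<Rightarrow> bool" where
  "adjacent G u v \<longleftrightarrow> u < v \<and> G (u, v) \<or> v < u \<and> G (v, u)"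

definition vertex_degree :: "nat \<Rightarrow> edges \<Rightarrow> nat \<Rightarrow> nat" where
  "vertex_degree N G v = card {u \<in> {..<N}. adjacent G u v}"

definition num_degree :: "nat \<Rightarrow> nat \<Rightarrow> edges \<Rightarrow> nat" where
  "num_degree N k G = card {v \<in> {..<N}. vertex_degree N G v = k}"

definition edges_given_positions ::
    "real \<Rightarrow> real \<Rightarrow> nat \<Rightarrow> (nat \<Rightarrow> real \<times> real) \<Rightarrow> edges pmf" where
  "edges_given_positions \<zeta> \<beta> N x =
     Pi_pmf {(u, v). u < v \<and> v < N} False
       (\<lambda>(u, v). bernoulli_pmf (connection_prob \<zeta> \<beta> (disc_radius \<zeta> N) (x u) (x v)))"

text \<open>The law of the random graph \<open>\<G>(N; \<zeta>, \<alpha>, \<beta>)\<close>.\<close>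

definition random_graph :: "real \<Rightarrow> real \<Rightarrow> real \<Rightarrow> nat \<Rightarrow> edges measure" where
  "random_graph \<zeta> \<alpha> \<beta> N =
     positions \<zeta> \<alpha> N \<bind> (\<lambda>x. measure_pmf (edges_given_positions \<zeta> \<beta> N x))"

definition tendsto_in_probability ::
    "(nat \<Rightarrow> 'a measure) \<Rightarrow> (nat \<Rightarrow> 'a \<Rightarrow> real) \<Rightarrow> real \<Rightarrow> bool" where
  "tendsto_in_probability M X c \<longleftrightarrow>
     (\<forall>\<epsilon>>0. (\<lambda>n. measure (M n) {\<omega> \<in> space (M n). \<bar>X n \<omega> - c\<bar> > \<epsilon>}) \<longlonglongrightarrow> 0)"

definition mixed_poisson_prob :: "(real \<Rightarrow> real) \<Rightarrow> nat \<Rightarrow> real" where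
  "mixed_poisson_prob F k = (\<integral>t. exp (- t) * t ^ k / fact k \<partial>interval_measure F)"

definition mixing_constant :: "real \<Rightarrow> real \<Rightarrow> real \<Rightarrow> real" where
  "mixing_constant \<zeta> \<alpha> \<beta> = 4 * \<alpha> / (2 * \<alpha> - \<zeta>) * (1 / \<beta>) * (1 / sin (pi / \<beta>))"

definition mixing_cdf :: "real \<Rightarrow> real \<Rightarrow> real \<Rightarrow> real \<Rightarrow> real" where
  "mixing_cdf \<zeta> \<alpha> \<beta> t =
     (let K = mixing_constant \<zeta> \<alpha> \<beta>
      in if t \<ge> K then 1 - (K / t) powr (2 * \<alpha> / \<zeta>) else 0)"

subsection \<open>Well-definedness of the model\<close>

lemma exp_disc_radius: "\<zeta> > 0 \<Longrightarrow> N > 0 \<Longrightarrow> exp (\<zeta> * disc_radius \<zeta> N / 2) = real N"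
  by (simp add: disc_radius_def)

lemma cos_relative_angle: "cos (relative_angle a b) = cos (a - b)"
proof -
  have "cos \<bar>a - b\<bar> = cos (a - b)"
    by (simp add: abs_if cos_diff)
  moreover have "cos (2 * pi - \<bar>a - b\<bar>) = cos \<bar>a - b\<bar>"
    by (simp add: cos_diff)
  ultimately show ?thesis
    by (simp add: relative_angle_def min_def)
qed

lemma hyp_law_of_cosines_ge_1:
  fixes a b t :: real
  assumes "a \<ge> 0" "b \<ge> 0"
  shows "cosh a * cosh b - sinh a * sinh b * cos t \<ge> 1"
proof -
  have "sinh a * sinh b * cos t \<le> sinh a * sinh b * 1"
    using assms by (intro mult_left_mono) auto
  moreover have "cosh a * cosh b - sinh a * sinh b = cosh (a - b)"
    by (simp add: cosh_diff)
  ultimately show ?thesis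
    using cosh_real_ge_1[of "a - b"] by linarith
qed

lemma cosh_hyp_dist:
  assumes "\<zeta> > 0" "fst u \<ge> 0" "fst v \<ge> 0"
  shows "cosh (\<zeta> * hyp_dist \<zeta> u v) =
    cosh (\<zeta> * fst u) * cosh (\<zeta> * fst v)
      - sinh (\<zeta> * fst u) * sinh (\<zeta> * fst v) * cos (relative_angle (snd u) (snd v))"
  using assms hyp_law_of_cosines_ge_1[of "\<zeta> * fst u" "\<zeta> * fst v"]
  by (simp add: hyp_dist_def)

lemma hyp_dist_nonneg:
  assumes "\<zeta> > 0" "fst u \<ge> 0" "fst v \<ge> 0"
  shows "hyp_dist \<zeta> u v \<ge> 0"
  using assms hyp_law_of_cosines_ge_1[of "\<zeta> * fst u" "\<zeta> * fst v"]
  by (simp add: hyp_dist_def)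

lemma connection_prob_bounds: "connection_prob \<zeta> \<beta> R u v \<in> {0..1}"
  by (simp add: connection_prob_def add_nonneg_nonneg add_pos_pos less_imp_le)

lemma radial_density_measurable [measurable]: "radial_density \<alpha> R \<in> borel_measurable borel"
  unfolding radial_density_def sinh_def by measurable

lemma prob_space_radial:
  assumes "\<alpha> > 0" "R > 0"
  shows "prob_space (density lborel (\<lambda>r. ennreal (radial_density \<alpha> R r)))"
proof (rule prob_spaceI)
  define c where "c = cosh (\<alpha> * R) - 1"
  have "cosh (\<alpha> * R) \<noteq> 1"
    using assms arcosh_cosh_real[of "\<alpha> * R"] by auto
  then have c: "c > 0"
    using cosh_real_ge_1[of "\<alpha> * R"] unfolding c_def by linarith
  have "(\<integral>\<^sup>+ r. ennreal (\<alpha> * sinh (\<alpha> * r) / c) * indicator {0..R} r \<partial>lborel)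
      = ennreal (cosh (\<alpha> * R) / c - cosh (\<alpha> * 0) / c)"
  proof (rule nn_integral_FTC_Icc)
    show "(\<lambda>r. \<alpha> * sinh (\<alpha> * r) / c) \<in> borel_measurable borel"
      unfolding sinh_def by measurable
    show "((\<lambda>r. cosh (\<alpha> * r) / c) has_real_derivative \<alpha> * sinh (\<alpha> * x) / c) (at x)" for x
      using c by (auto intro!: derivative_eq_intros)
  qed (use assms c in auto)
  also have "cosh (\<alpha> * R) / c - cosh (\<alpha> * 0) / c = 1"
    using c assms by (simp add: c_def diff_divide_distrib [symmetric])
  finally have "(\<integral>\<^sup>+ r. ennreal (\<alpha> * sinh (\<alpha> * r) / c) * indicator {0..R} r \<partial>lborel) = 1"
    by simp
  moreover have "(\<integral>\<^sup>+ r. ennreal (radial_density \<alpha> R r) \<partial>lborel)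
      = (\<integral>\<^sup>+ r. ennreal (\<alpha> * sinh (\<alpha> * r) / c) * indicator {0..R} r \<partial>lborel)"
    by (intro nn_integral_cong) (auto simp: radial_density_def c_def split: split_indicator)
  ultimately show "emeasure (density lborel (\<lambda>r. ennreal (radial_density \<alpha> R r)))
      (space (density lborel (\<lambda>r. ennreal (radial_density \<alpha> R r)))) = 1"
    by (simp add: emeasure_density)
qed

lemma prob_space_point_distribution:
  assumes "\<alpha> > 0" "R > 0"
  shows "prob_space (point_distribution \<alpha> R)"
proof -
  interpret A: prob_space "density lborel (\<lambda>r. ennreal (radial_density \<alpha> R r))"
    by (rule prob_space_radial[OF assms])
  interpret B: prob_space "uniform_measure lborel {0<..2 * pi}"
    by (rule prob_space_uniform_measure) auto
  interpret pair_prob_space "density lborel (\<lambda>r. ennreal (radial_density \<alpha> R r))"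
      "uniform_measure lborel {0<..2 * pi}" ..
  show ?thesis
    unfolding point_distribution_def by (rule prob_space_axioms)
qed

lemma sets_point_distribution [measurable_cong]:
  "sets (point_distribution \<alpha> R) = sets (borel \<Otimes>\<^sub>M borel)"
  unfolding point_distribution_def by (intro sets_pair_measure_cong) auto

lemma prob_space_positions:
  assumes "\<zeta> > 0" "\<alpha> > 0" "N \<ge> 2"
  shows "prob_space (positions \<zeta> \<alpha> N)"
  unfolding positions_def
  by (intro prob_space_PiM prob_space_point_distribution) (use assms in \<open>auto simp: disc_radius_def\<close>)

lemma connection_prob_measurable:
  "(\<lambda>(u, v). connection_prob \<zeta> \<beta> R u v)
     \<in> borel_measurable ((borel \<Otimes>\<^sub>M borel) \<Otimes>\<^sub>M (borel \<Otimes>\<^sub>M borel))"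
  unfolding connection_prob_def hyp_dist_def arcosh_def relative_angle_def cosh_def sinh_def
  by measurable

lemma edges_given_positions_measurable:
  "(\<lambda>x. measure_pmf (edges_given_positions \<zeta> \<beta> N x))
     \<in> positions \<zeta> \<alpha> N \<rightarrow>\<^sub>M prob_algebra (count_space UNIV)"
proof -
  define P where "P = {(u, v). u < v \<and> v < N}"
  have P: "finite P"
    by (rule finite_subset[of _ "{..<N} \<times> {..<N}"]) (auto simp: P_def)
  define S where "S = PiE_dflt P False (\<lambda>_. UNIV :: bool set)"
  have S: "finite S"
    unfolding S_def using P by (intro finite_PiE_dflt) auto
  let ?p = "\<lambda>x (u, v). connection_prob \<zeta> \<beta> (disc_radius \<zeta> N) (x u) (x v)"
  have pmf_meas: "(\<lambda>x. pmf (edges_given_positions \<zeta> \<beta> N x) G) \<in> borel_measurable (positions \<zeta> \<alpha> N)"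
    if "G \<in> S" for G
  proof -
    have "pmf (edges_given_positions \<zeta> \<beta> N x) G = (\<Prod>e\<in>P. if G e then ?p x e else 1 - ?p x e)" for x
    proof -
      have "pmf (edges_given_positions \<zeta> \<beta> N x) G
          = (\<Prod>e\<in>P. pmf (case e of (u, v) \<Rightarrow> bernoulli_pmf (?p x (u, v))) (G e))"
        unfolding edges_given_positions_def P_def[symmetric] using that P
        by (subst pmf_Pi') (auto simp: S_def PiE_dflt_def case_prod_unfold)
      also have "\<dots> = (\<Prod>e\<in>P. if G e then ?p x e else 1 - ?p x e)"
        using connection_prob_bounds by (intro prod.cong) (auto split: prod.splits)
      finally show ?thesis .
    qed
    moreover have "(\<lambda>x. ?p x e) \<in> borel_measurable (positions \<zeta> \<alpha> N)" if e: "e \<in> P" for e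
    proof -
      obtain u v where uv: "e = (u, v)" "u < N" "v < N"
        using e by (auto simp: P_def)
      have c [measurable]: "(\<lambda>x. x i) \<in> positions \<zeta> \<alpha> N \<rightarrow>\<^sub>M borel \<Otimes>\<^sub>M borel" if "i < N" for i
        using that measurable_component_singleton[of i "{..<N}"
            "\<lambda>_. point_distribution \<alpha> (disc_radius \<zeta> N)"]
        unfolding positions_def
        by (simp cong: measurable_cong_sets add: sets_point_distribution)
      have "(\<lambda>x. (x u, x v)) \<in> positions \<zeta> \<alpha> N \<rightarrow>\<^sub>M (borel \<Otimes>\<^sub>M borel) \<Otimes>\<^sub>M (borel \<Otimes>\<^sub>M borel)"
        using uv c by (intro measurable_Pair) auto
      from measurable_compose[OF this connection_prob_measurable] show ?thesis
        by (simp add: uv)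
    qed
    ultimately show ?thesis
      by (auto intro!: borel_measurable_prod borel_measurable_diff)
  qed
  show ?thesis
  proof (intro measurable_prob_algebraI measurable_subprob_algebra)
    fix A :: "edges set"
    have "emeasure (measure_pmf (edges_given_positions \<zeta> \<beta> N x)) A
        = (\<Sum>G\<in>A \<inter> S. ennreal (pmf (edges_given_positions \<zeta> \<beta> N x) G))" for x
    proof -
      have "set_pmf (edges_given_positions \<zeta> \<beta> N x) \<subseteq> S"
        unfolding edges_given_positions_def P_def[symmetric] S_def
        using set_Pi_pmf_subset[OF P] by (fastforce simp: PiE_dflt_def)
      then have "emeasure (measure_pmf (edges_given_positions \<zeta> \<beta> N x)) A
          = emeasure (measure_pmf (edges_given_positions \<zeta> \<beta> N x)) (A \<inter> S)"
        by (intro emeasure_eq_AE) (auto simp: AE_measure_pmf_iff)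
      then show ?thesis
        using S by (simp add: emeasure_measure_pmf_finite sum_ennreal)
    qed
    then show "(\<lambda>x. emeasure (measure_pmf (edges_given_positions \<zeta> \<beta> N x)) A)
        \<in> borel_measurable (positions \<zeta> \<alpha> N)"
      using pmf_meas by (auto intro!: borel_measurable_sum measurable_compose[OF _ measurable_ennreal])
  qed (auto simp: measure_pmf.prob_space_axioms measure_pmf.subprob_space_axioms)
qed

lemma prob_space_random_graph:
  assumes "\<zeta> > 0" "\<alpha> > 0" "N \<ge> 2"
  shows "prob_space (random_graph \<zeta> \<alpha> \<beta> N)"
  unfolding random_graph_def
  by (rule prob_space_bind'[OF _ edges_given_positions_measurable])
     (simp add: space_prob_algebra prob_space_positions assms)

lemma sets_random_graph: "sets (random_graph \<zeta> \<alpha> \<beta> N) = UNIV"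
proof -
  have "space (positions \<zeta> \<alpha> N) \<noteq> {}"
    by (auto simp: positions_def space_PiM PiE_eq_empty_iff point_distribution_def space_pair_measure)
  then show ?thesis
    unfolding random_graph_def
    using measurable_prob_algebraD[OF edges_given_positions_measurable] 
    by (subst sets_bind[where N = "count_space UNIV"]) auto
qed

end

theory Submission
  imports Defs "HOL-Real_Asymp.Real_Asymp"
begin

text \<open>
  Let \<open>p x\<close> be the probability that a vertex at \<open>x\<close> is joined to a random vertex. Given the
  positions the edges are independent, so \<open>E (s ^ deg v) = E ((1 - (1 - s) p) ^ (N - 1))\<close> for
  \<open>s \<in> [0, 1]\<close>, and dropping the edge between \<open>u \<noteq> v\<close> gives
  \<open>E (s ^ deg u s ^ deg v) \<le> (E ((1 - (1 - s) p) ^ (N - 2)))\<^sup>2 + N E (p\<^sup>2)\<close>.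

  For a vertex at distance \<open>t\<close> from the boundary, rescaling the angle by \<open>N\<close> and dominated
  convergence give \<open>N p \<longlonglongrightarrow> K exp (\<zeta> t / 2)\<close>, where \<open>t\<close> is asymptotically exponential with rate
  \<open>\<alpha>\<close>; moreover \<open>N p \<le> C exp (\<zeta> t / 2)\<close>, which is integrable since \<open>\<zeta> < 2 \<alpha>\<close>. Hence
  \<open>N E (p\<^sup>2) \<longlonglongrightarrow> 0\<close>, and the generating function of the empirical degree distribution, the average
  of \<open>s ^ deg v\<close> over the vertices, converges in mean square to the generating function of the
  mixed Poisson law.

  Finally the indicator of \<open>d = k\<close> is a continuous function of \<open>(1 / 2) ^ d\<close>. By Weierstrass the
  weight of a distribution at \<open>k\<close> is therefore, uniformly over all distributions on the natural
  numbers, close to a fixed linear combination of the values of its generating function at the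
  points \<open>(1 / 2) ^ j\<close>.
\<close>

subsection \<open>The integral of \<open>1 / (1 + x powr b)\<close> over the half-line\<close>

lemma Gamma_reflection_real:
  fixes x :: real
  shows "Gamma x * Gamma (1 - x) = pi / sin (pi * x)"
proof -
  have "complex_of_real (Gamma x * Gamma (1 - x)) = Gamma (of_real x) * Gamma (1 - of_real x)"
    using Gamma_complex_of_real[of x] Gamma_complex_of_real[of "1 - x"] by simp
  also have "\<dots> = of_real pi / sin (of_real (pi * x))"
    by (subst Gamma_reflection_complex) simp
  also have "\<dots> = of_real (pi / sin (pi * x))"
    by (subst sin_of_real) simp
  finally show ?thesis
    by (simp only: of_real_eq_iff)
qed

lemma Beta_one_minus_one_plus:
  fixes a :: real
  assumes "0 < a"
  shows "Beta (1 - a) (1 + a) = pi * a / sin (pi * a)"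
proof -
  have "Gamma (1 + a) = a * Gamma a"
    using Gamma_plus1[of a] nonpos_Ints_nonpos[of a] assms by (auto simp: add.commute)
  then show ?thesis
    using Gamma_reflection_real[of a] by (simp add: Beta_def Gamma_numeral mult_ac)
qed

lemma nn_integral_powr_one_minus_powr:
  fixes a :: real
  assumes "0 < a" "a < 1"
  shows "(\<integral>\<^sup>+u. ennreal (u powr - a * (1 - u) powr a) * indicator {0<..<1} u \<partial>lborel)
    = ennreal (pi * a / sin (pi * a))"
proof (rule nn_integral_has_integral_lebesgue')
  show "((\<lambda>u. u powr - a * (1 - u) powr a) has_integral pi * a / sin (pi * a)) {0<..<1}"
    using has_integral_Beta_real[of "1 - a" "1 + a"] assms
    by (simp add: Beta_one_minus_one_plus has_integral_Icc_iff_Ioo)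
qed auto

lemma less_inverse_one_plus_powr_iff:
  fixes b u x :: real
  assumes "b > 0" "0 < u" "u < 1" "x > 0"
  shows "u < 1 / (1 + x powr b) \<longleftrightarrow> x < u powr - (1 / b) * (1 - u) powr (1 / b)"
proof -
  define y where "y = u powr - (1 / b) * (1 - u) powr (1 / b)"
  have "y > 0" "y powr b = (1 - u) / u"
    using assms by (simp_all add: y_def powr_mult powr_divide powr_powr powr_minus_divide)
  moreover have "u < 1 / (1 + x powr b) \<longleftrightarrow> x powr b < (1 - u) / u"
    using assms by (simp add: field_simps add_pos_pos)
  ultimately have "u < 1 / (1 + x powr b) \<longleftrightarrow> x powr b < y powr b"
    by simp
  also have "\<dots> \<longleftrightarrow> x < y"
    using assms powr_less_mono2[of b x y] powr_mono2[of b y x] \<open>y > 0\<close> by linarith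
  finally show ?thesis
    by (simp add: y_def)
qed

text \<open>Layer cake: the superlevel set \<open>{x > 0. 1 / (1 + x powr b) > u}\<close> is an interval of length
  \<open>((1 - u) / u) powr (1 / b)\<close>, and the integral of this length over \<open>u\<close> is a Beta integral.\<close>

lemma nn_integral_inverse_one_plus_powr:
  fixes b :: real
  assumes "b > 1"
  shows "(\<integral>\<^sup>+x. ennreal (1 / (1 + x powr b)) * indicator {0<..} x \<partial>lborel)
    = ennreal (pi / (b * sin (pi / b)))"
proof -
  let ?h = "\<lambda>x u :: real.
    indicator {u. 0 < u \<and> u < 1 / (1 + x powr b)} u * indicator {0<..} x :: ennreal"
  let ?l = "\<lambda>u. u powr - (1 / b) * (1 - u) powr (1 / b)"
  have "(\<integral>\<^sup>+x. ennreal (1 / (1 + x powr b)) * indicator {0<..} x \<partial>lborel)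
      = (\<integral>\<^sup>+x. (\<integral>\<^sup>+u. ?h x u \<partial>lborel) \<partial>lborel)"
  proof (intro nn_integral_cong)
    fix x :: real
    have "{u. 0 < u \<and> u < 1 / (1 + x powr b)} = {0<..<1 / (1 + x powr b)}"
      by auto
    then show "ennreal (1 / (1 + x powr b)) * indicator {0<..} x = (\<integral>\<^sup>+u. ?h x u \<partial>lborel)"
      by (simp add: nn_integral_multc add_nonneg_nonneg)
  qed
  also have "\<dots> = (\<integral>\<^sup>+u. (\<integral>\<^sup>+x. ?h x u \<partial>lborel) \<partial>lborel)"
    by (rule lborel_pair.Fubini') measurable
  also have "\<dots> = (\<integral>\<^sup>+u. ennreal (?l u) * indicator {0<..<1} u \<partial>lborel)"
  proof (intro nn_integral_cong)
    fix u :: real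
    have "?h x u = indicator {0<..<?l u} x * indicator {0<..<1} u" for x
    proof -
      have "1 / (1 + x powr b) \<le> 1"
        by (simp add: add_pos_nonneg)
      then show ?thesis
        using less_inverse_one_plus_powr_iff[of b u x] assms
        by (cases "0 < u \<and> u < 1 \<and> 0 < x") (auto simp: indicator_def)
    qed
    then show "(\<integral>\<^sup>+x. ?h x u \<partial>lborel) = ennreal (?l u) * indicator {0<..<1} u"
      by (simp add: nn_integral_multc)
  qed
  also have "\<dots> = ennreal (pi / (b * sin (pi / b)))"
    using nn_integral_powr_one_minus_powr[of "1 / b"] assms by simp
  finally show ?thesis .
qed

lemma has_bochner_integral_inverse_one_plus_powr:
  fixes a b :: real
  assumes "b > 1" "a > 0"
  shows "has_bochner_integral lborel (\<lambda>x. indicator {0<..} x / (1 + (a * x) powr b))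
           (pi / (b * sin (pi / b)) / a)"
proof -
  have "sin (pi / b) > 0"
    using assms by (intro sin_gt_zero) (auto simp: field_simps)
  moreover have "(\<integral>\<^sup>+x. ennreal (indicator {0<..} x / (1 + x powr b)) \<partial>lborel)
      = ennreal (pi / (b * sin (pi / b)))"
    by (subst nn_integral_inverse_one_plus_powr[OF assms(1), symmetric])
      (auto intro!: nn_integral_cong simp: indicator_def)
  ultimately have "has_bochner_integral lborel (\<lambda>x. indicator {0<..} x / (1 + x powr b))
      (pi / (b * sin (pi / b)))"
    using assms
    by (intro has_bochner_integral_nn_integral)
      (auto simp: add_nonneg_nonneg intro!: divide_nonneg_pos)
  then have "has_bochner_integral lborel (\<lambda>x. indicator {0<..} (a * x) / (1 + (a * x) powr b))
      (pi / (b * sin (pi / b)) /\<^sub>R \<bar>a\<bar>)"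
    using assms
    by (subst (asm) lborel_has_bochner_integral_real_affine_iff[where c = a and t = 0]) auto
  moreover have "indicator {0<..} (a * x) = (indicator {0<..} x :: real)" for x
    using assms by (auto simp: indicator_def zero_less_mult_iff)
  ultimately show ?thesis
    using assms by (simp add: field_simps)
qed

subsection \<open>Integrals of even periodic functions\<close>

lemma nn_integral_periodic:
  fixes f :: "real \<Rightarrow> ennreal"
  assumes [measurable]: "f \<in> borel_measurable borel" and "p > 0" and periodic: "\<And>x. f (x + p) = f x"
  shows "(\<integral>\<^sup>+x. f x * indicator {a<..a + p} x \<partial>lborel) = (\<integral>\<^sup>+x. f x * indicator {0<..p} x \<partial>lborel)"
proof -
  interpret periodic_fun_simple f p
    by standard (rule periodic)
  define k where "k = \<lfloor>a / p\<rfloor>"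
  define b where "b = a - of_int k * p"
  have "of_int k \<le> a / p" "a / p < of_int k + 1"
    unfolding k_def by linarith+
  then have b_bounds: "0 \<le> b" "b \<le> p"
    using \<open>p > 0\<close> by (auto simp: b_def field_simps)
  have "(\<integral>\<^sup>+x. f x * indicator {a<..a + p} x \<partial>lborel)
      = (\<integral>\<^sup>+x. f x * indicator {b<..b + p} x \<partial>lborel)"
    by (subst nn_integral_real_affine[where c = 1 and t = "of_int k * p"])
      (auto simp: b_def indicator_def plus_of_int add.commute[of "of_int k * p"]
        intro!: nn_integral_cong)
  also have "\<dots> = (\<integral>\<^sup>+x. f x * indicator {b<..p} x + f x * indicator {p<..b + p} x \<partial>lborel)"
    using b_bounds by (intro nn_integral_cong) (auto simp: indicator_def)
  also have "\<dots>
      = (\<integral>\<^sup>+x. f x * indicator {b<..p} x \<partial>lborel) + (\<integral>\<^sup>+x. f x * indicator {p<..b + p} x \<partial>lborel)"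
    by (intro nn_integral_add) auto
  also have "(\<integral>\<^sup>+x. f x * indicator {p<..b + p} x \<partial>lborel)
      = (\<integral>\<^sup>+x. f x * indicator {0<..b} x \<partial>lborel)"
    by (subst nn_integral_real_affine[where c = 1 and t = p])
      (auto simp: indicator_def periodic add.commute[of p] intro!: nn_integral_cong)
  also have "(\<integral>\<^sup>+x. f x * indicator {b<..p} x \<partial>lborel) + (\<integral>\<^sup>+x. f x * indicator {0<..b} x \<partial>lborel)
      = (\<integral>\<^sup>+x. f x * indicator {b<..p} x + f x * indicator {0<..b} x \<partial>lborel)"
    by (intro nn_integral_add[symmetric]) auto
  also have "\<dots> = (\<integral>\<^sup>+x. f x * indicator {0<..p} x \<partial>lborel)"
    using b_bounds by (intro nn_integral_cong) (auto simp: indicator_def)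
  finally show ?thesis .
qed

lemma nn_integral_even_periodic:
  fixes f :: "real \<Rightarrow> ennreal"
  assumes [measurable]: "f \<in> borel_measurable borel" and "h > 0"
    and periodic: "\<And>x. f (x + 2 * h) = f x" and even: "\<And>x. f (- x) = f x"
  shows "(\<integral>\<^sup>+x. f (a - x) * indicator {0<..2 * h} x \<partial>lborel)
      = 2 * (\<integral>\<^sup>+x. f x * indicator {0<..h} x \<partial>lborel)"
proof -
  have "(\<integral>\<^sup>+x. f (a - x) * indicator {0<..2 * h} x \<partial>lborel)
      = (\<integral>\<^sup>+x. f x * indicator {- a<..- a + 2 * h} x \<partial>lborel)"
    by (subst nn_integral_real_affine[where c = 1 and t = a])
      (auto simp: indicator_def even intro!: nn_integral_cong)
  also have "\<dots> = (\<integral>\<^sup>+x. f x * indicator {- h<..- h + 2 * h} x \<partial>lborel)"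
    using \<open>h > 0\<close>
    by (simp only: nn_integral_periodic[OF assms(1) _ periodic] mult_pos_pos zero_less_numeral)
  also have "\<dots> = (\<integral>\<^sup>+x. f x * indicator {- h<..0} x + f x * indicator {0<..h} x \<partial>lborel)"
    using \<open>h > 0\<close> by (intro nn_integral_cong) (auto simp: indicator_def)
  also have "\<dots>
      = (\<integral>\<^sup>+x. f x * indicator {- h<..0} x \<partial>lborel) + (\<integral>\<^sup>+x. f x * indicator {0<..h} x \<partial>lborel)"
    by (intro nn_integral_add) auto
  also have "(\<integral>\<^sup>+x. f x * indicator {- h<..0} x \<partial>lborel)
      = (\<integral>\<^sup>+x. f x * indicator {0..<h} x \<partial>lborel)"
    by (subst nn_integral_real_affine[where c = "- 1" and t = 0])
      (auto simp: indicator_def even intro!: nn_integral_cong)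
  also have "\<dots> = (\<integral>\<^sup>+x. f x * indicator {0<..h} x \<partial>lborel)"
  proof (rule nn_integral_cong_AE)
    have "AE x in lborel. x \<noteq> 0 \<and> x \<noteq> h"
      by (intro AE_conjI AE_lborel_singleton)
    then show "AE x in lborel. f x * indicator {0..<h} x = f x * indicator {0<..h} x"
      by eventually_elim (auto simp: indicator_def)
  qed
  finally show ?thesis
    by (simp only: mult_2)
qed

lemma integral_even_periodic:
  fixes f :: "real \<Rightarrow> real"
  assumes [measurable]: "f \<in> borel_measurable borel" and "h > 0" and nonneg: "\<And>x. 0 \<le> f x"
    and "\<And>x. f (x + 2 * h) = f x" "\<And>x. f (- x) = f x"
  shows "(\<integral>x. indicator {0<..2 * h} x * f (a - x) \<partial>lborel)
      = 2 * (\<integral>x. indicator {0<..h} x * f x \<partial>lborel)"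
proof -
  have "ennreal (indicator A x * f y) = ennreal (f y) * indicator A x" for A and x y :: real
    by (simp add: indicator_def)
  then show ?thesis
    using nn_integral_even_periodic[of "\<lambda>x. ennreal (f x)" h a] assms
    by (simp add: integral_eq_nn_integral enn2real_mult)
qed

subsection \<open>Limits of integrals and powers\<close>

lemma integral_dominated_convergence_eventually:
  fixes f :: "'a \<Rightarrow> 'b::{banach, second_countable_topology}"
  assumes "f \<in> borel_measurable M" "\<And>i. s i \<in> borel_measurable M" "integrable M w"
    and "AE x in M. (\<lambda>i. s i x) \<longlonglongrightarrow> f x"
    and "\<forall>\<^sub>F i in sequentially. AE x in M. norm (s i x) \<le> w x"
  shows "(\<lambda>i. integral\<^sup>L M (s i)) \<longlonglongrightarrow> integral\<^sup>L M f"
proof -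
  from assms(5) obtain k where dominated: "\<And>i. i \<ge> k \<Longrightarrow> AE x in M. norm (s i x) \<le> w x"
    by (auto simp: eventually_sequentially)
  have "(\<lambda>i. integral\<^sup>L M (s (i + k))) \<longlonglongrightarrow> integral\<^sup>L M f"
  proof (rule integral_dominated_convergence)
    show "AE x in M. (\<lambda>i. s (i + k) x) \<longlonglongrightarrow> f x"
      using assms(4) by eventually_elim (rule LIMSEQ_ignore_initial_segment)
  qed (use assms(1-3) dominated in auto)
  then show ?thesis
    by (rule LIMSEQ_offset)
qed

lemma tendsto_power_one_minus:
  fixes a :: "'a \<Rightarrow> real" and m :: "'a \<Rightarrow> nat"
  assumes lim: "((\<lambda>x. real (m x) * a x) \<longlongrightarrow> l) F" and null: "(a \<longlongrightarrow> 0) F"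
  shows "((\<lambda>x. (1 - a x) ^ m x) \<longlongrightarrow> exp (- l)) F"
proof (rule Lim_transform_eventually)
  have small: "\<forall>\<^sub>F x in F. \<bar>a x\<bar> < 1 / 2"
    using tendsto_rabs_zero[OF null] by (rule order_tendstoD) simp
  have "((\<lambda>x. real (m x) * (ln (1 - a x) + a x)) \<longlongrightarrow> 0) F"
  proof (rule Lim_null_comparison)
    show "((\<lambda>x. 2 * \<bar>real (m x) * a x\<bar> * \<bar>a x\<bar>) \<longlongrightarrow> 0) F"
      using tendsto_mult[OF tendsto_mult[OF tendsto_const tendsto_rabs[OF lim]]
          tendsto_rabs_zero[OF null]]
      by simp
    show "\<forall>\<^sub>F x in F. norm (real (m x) * (ln (1 - a x) + a x)) \<le> 2 * \<bar>real (m x) * a x\<bar> * \<bar>a x\<bar>"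
      using small
    proof eventually_elim
      case (elim x)
      then have "\<bar>ln (1 - a x) + a x\<bar> \<le> 2 * (a x)\<^sup>2"
        using abs_ln_one_plus_x_minus_x_bound[of "- a x"] by simp
      then have "real (m x) * \<bar>ln (1 - a x) + a x\<bar> \<le> real (m x) * (2 * (a x)\<^sup>2)"
        by (intro mult_left_mono) auto
      then show ?case
        by (simp add: abs_mult power2_eq_square mult_ac)
    qed
  qed
  from tendsto_diff[OF this lim] have "((\<lambda>x. real (m x) * ln (1 - a x)) \<longlongrightarrow> - l) F"
    by (simp add: distrib_left)
  then show "((\<lambda>x. exp (real (m x) * ln (1 - a x))) \<longlongrightarrow> exp (- l)) F"
    by (rule tendsto_exp)
  show "\<forall>\<^sub>F x in F. exp (real (m x) * ln (1 - a x)) = (1 - a x) ^ m x"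
    using small by eventually_elim (simp add: exp_of_nat_mult)
qed

subsection \<open>The exponential distribution\<close>

abbreviation exponential_measure :: "real \<Rightarrow> real measure" where
  "exponential_measure a \<equiv> density lborel (exponential_density a)"

lemma has_bochner_integral_exponential_density:
  assumes "a > 0"
  shows "has_bochner_integral lborel (exponential_density a) 1"
proof -
  interpret prob_space "exponential_measure a"
    by (rule prob_space_exponential_density[OF assms])
  have "(\<integral>\<^sup>+t. ennreal (exponential_density a t) \<partial>lborel) = ennreal 1"
    using emeasure_space_1 by (simp add: emeasure_density)
  then show ?thesis
    using assms by (intro has_bochner_integral_nn_integral) (auto simp: exponential_density_nonneg)
qed

lemma has_bochner_integral_exponential_density_mult_exp:
  assumes "\<gamma> < a"
  shows "has_bochner_integral lborel (\<lambda>t. exponential_density a t * exp (\<gamma> * t)) (a / (a - \<gamma>))"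
proof -
  have "exponential_density a t * exp (\<gamma> * t) = a / (a - \<gamma>) * exponential_density (a - \<gamma>) t" for t
  proof -
    have "exp (- t * a) * exp (\<gamma> * t) = exp (- t * (a - \<gamma>))"
      by (simp add: algebra_simps flip: exp_add)
    then show ?thesis
      using assms by (simp add: exponential_density_def)
  qed
  then show ?thesis
    using has_bochner_integral_mult_right[OF has_bochner_integral_exponential_density[of "a - \<gamma>"],
        of "a / (a - \<gamma>)"]
      assms by simp
qed

lemma exponential_measure_atMost:
  assumes "\<alpha> > 0"
  shows "measure (exponential_measure \<alpha>) {..x} = (if x < 0 then 0 else 1 - exp (- (\<alpha> * x)))"
  using emeasure_erlang_density[OF assms, of 0 x] assms
  by (simp add: measure_def erlang_CDF_def)

lemma cdf_distr_exp_exponential: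
  assumes "\<alpha> > 0" "\<gamma> > 0" "K > 0"
  shows "cdf (distr (exponential_measure \<alpha>) borel (\<lambda>t. K * exp (\<gamma> * t))) x
    = (if x \<ge> K then 1 - (K / x) powr (\<alpha> / \<gamma>) else 0)"
proof -
  have cdf_eq: "cdf (distr (exponential_measure \<alpha>) borel (\<lambda>t. K * exp (\<gamma> * t))) x
      = measure (exponential_measure \<alpha>) {t. K * exp (\<gamma> * t) \<le> x}"
    unfolding cdf_def by (subst measure_distr) (auto simp: vimage_def)
  show ?thesis
  proof (cases "x > 0")
    case True
    define \<tau> where "\<tau> = ln (x / K) / \<gamma>"
    have "K * exp (\<gamma> * t) \<le> x \<longleftrightarrow> exp (\<gamma> * t) \<le> x / K" for t
      using assms by (simp add: field_simps)
    moreover have "exp (\<gamma> * t) \<le> x / K \<longleftrightarrow> \<gamma> * t \<le> ln (x / K)" for t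
      using True assms by (simp add: ln_ge_iff)
    moreover have "\<gamma> * t \<le> ln (x / K) \<longleftrightarrow> t \<le> \<tau>" for t
      using assms by (simp add: \<tau>_def field_simps)
    ultimately have "{t. K * exp (\<gamma> * t) \<le> x} = {..\<tau>}"
      by auto
    moreover have "\<tau> < 0 \<longleftrightarrow> x < K"
      using True assms by (simp add: \<tau>_def divide_less_0_iff)
    moreover have "- (\<alpha> * \<tau>) = \<alpha> / \<gamma> * ln (K / x)"
      using True assms by (simp add: \<tau>_def ln_div right_diff_distrib diff_divide_distrib)
    then have "exp (- (\<alpha> * \<tau>)) = (K / x) powr (\<alpha> / \<gamma>)"
      using True assms by (simp add: powr_def)
    ultimately show ?thesis
      using assms by (simp add: cdf_eq exponential_measure_atMost not_less)
  next
    case False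
    then have "\<not> K * exp (\<gamma> * t) \<le> x" for t
      using mult_pos_pos[OF assms(3) exp_gt_zero[of "\<gamma> * t"]] by linarith
    then show ?thesis
      using False assms by (simp add: cdf_eq)
  qed
qed

lemma (in real_distribution) interval_measure_cdf: "interval_measure (cdf M) = M"
proof (rule cdf_unique)
  show "real_distribution (interval_measure (cdf M))"
    using cdf_nondecreasing cdf_is_right_cont cdf_lim_at_bot cdf_lim_at_top_prob
    by (intro real_distribution_interval_measure) auto
  show "cdf (interval_measure (cdf M)) = cdf M"
    using cdf_nondecreasing cdf_is_right_cont cdf_lim_at_bot by (intro cdf_interval_measure) auto
qed (rule real_distribution_axioms)

subsection \<open>Random variables with values in the unit interval\<close>

lemma mult_in_unit_interval: "x \<in> {0..1} \<Longrightarrow> y \<in> {0..1} \<Longrightarrow> x * y \<in> {0..1 :: real}"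
  by (auto intro: mult_le_one)

lemma one_minus_in_unit_interval: "x \<in> {0..1} \<Longrightarrow> 1 - x \<in> {0..1 :: real}"
  by simp

lemma power_in_unit_interval: "x \<in> {0..1} \<Longrightarrow> x ^ n \<in> {0..1 :: real}"
  by (simp add: power_le_one)

lemma prod_in_unit_interval:
  fixes f :: "'a \<Rightarrow> real"
  shows "(\<And>i. i \<in> I \<Longrightarrow> f i \<in> {0..1}) \<Longrightarrow> prod f I \<in> {0..1}"
  by (auto intro: prod_nonneg prod_le_1)

lemmas unit_interval_intros =
  mult_in_unit_interval one_minus_in_unit_interval power_in_unit_interval prod_in_unit_interval

lemma prod_le_prod_subset:
  fixes f :: "'a \<Rightarrow> real"
  assumes "finite B" "A \<subseteq> B" "\<And>b. b \<in> B \<Longrightarrow> f b \<in> {0..1}"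
  shows "prod f B \<le> prod f A"
proof -
  have "prod f B = prod f (B - A) * prod f A"
    using assms by (intro prod.subset_diff)
  also have "\<dots> \<le> 1 * prod f A"
    using assms by (intro mult_right_mono prod_le_1 prod_nonneg) auto
  finally show ?thesis
    by simp
qed

lemma power_le_power_add:
  fixes a b q :: real
  assumes "a \<in> {0..1}" "b \<in> {0..1}" "a \<le> b + q" "0 \<le> q"
  shows "a ^ n \<le> b ^ n + real n * q"
proof (cases "a \<le> b")
  case True
  then have "a ^ n \<le> b ^ n"
    using assms by (intro power_mono) auto
  moreover have "0 \<le> real n * q"
    using assms by simp
  ultimately show ?thesis
    by linarith
next
  case False
  have "\<bar>a ^ n - b ^ n\<bar> \<le> real n * \<bar>a - b\<bar>"
    using norm_power_diff[of a b n] assms by simp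
  also have "\<dots> \<le> real n * q"
    using False assms by (intro mult_left_mono) auto
  finally show ?thesis
    by linarith
qed

lemma (in prob_space) integrable_unit_interval:
  fixes f :: "'a \<Rightarrow> real"
  assumes "f \<in> borel_measurable M" "\<And>x. x \<in> space M \<Longrightarrow> f x \<in> {0..1}"
  shows "integrable M f"
  using assms by (intro integrable_const_bound[of _ 1] AE_I2) auto

lemma (in prob_space) expectation_in_unit_interval:
  fixes f :: "'a \<Rightarrow> real"
  assumes "\<And>x. x \<in> space M \<Longrightarrow> f x \<in> {0..1}"
  shows "expectation f \<in> {0..1}"
proof -
  have "expectation f \<le> expectation (\<lambda>_. 1)"
    using assms by (intro integral_mono') auto
  moreover have "0 \<le> expectation f"
    using assms by (intro Bochner_Integration.integral_nonneg) auto
  ultimately show ?thesis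
    by (simp add: prob_space)
qed

lemma (in prob_space) expectation_average_diff_square_le:
  fixes X :: "'i \<Rightarrow> 'a \<Rightarrow> real"
  assumes "finite I" "I \<noteq> {}" "0 \<le> b"
    and [measurable]: "\<And>i. i \<in> I \<Longrightarrow> X i \<in> borel_measurable M"
    and bounds: "\<And>i \<omega>. i \<in> I \<Longrightarrow> X i \<omega> \<in> {0..1}"
    and mean: "\<And>i. i \<in> I \<Longrightarrow> expectation (X i) = a"
    and cross: "\<And>i j. i \<in> I \<Longrightarrow> j \<in> I \<Longrightarrow> i \<noteq> j \<Longrightarrow> expectation (\<lambda>\<omega>. X i \<omega> * X j \<omega>) \<le> b"
  shows "expectation (\<lambda>\<omega>. ((\<Sum>i\<in>I. X i \<omega>) / card I - l)\<^sup>2) \<le> 1 / card I + b - 2 * l * a + l\<^sup>2"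
proof -
  define n where "n = real (card I)"
  have "n > 0"
    using assms by (simp add: n_def card_gt_0_iff)
  have integrable_X: "integrable M (X i)" if "i \<in> I" for i
    using that by (intro integrable_unit_interval bounds) measurable
  have integrable_XX: "integrable M (\<lambda>\<omega>. X i \<omega> * X j \<omega>)" if "i \<in> I" "j \<in> I" for i j
    using that by (intro integrable_unit_interval mult_in_unit_interval bounds) measurable
  have "expectation (\<lambda>\<omega>. X i \<omega> * X j \<omega>) \<le> (if j = i then 1 else 0) + b" if "i \<in> I" "j \<in> I" for i j
    using cross[OF that]
      expectation_in_unit_interval[of "\<lambda>\<omega>. X i \<omega> * X j \<omega>",
        OF mult_in_unit_interval[OF bounds bounds], OF that]
      \<open>0 \<le> b\<close> by auto
  then have "(\<Sum>i\<in>I. \<Sum>j\<in>I. expectation (\<lambda>\<omega>. X i \<omega> * X j \<omega>))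
      \<le> (\<Sum>i\<in>I. \<Sum>j\<in>I. (if j = i then 1 else 0) + b)"
    by (intro sum_mono)
  also have "\<dots> = n + n\<^sup>2 * b"
    using assms(1) by (simp add: n_def sum.distrib power2_eq_square algebra_simps)
  finally have square: "(\<Sum>i\<in>I. \<Sum>j\<in>I. expectation (\<lambda>\<omega>. X i \<omega> * X j \<omega>)) \<le> n + n\<^sup>2 * b" .
  have "expectation (\<lambda>\<omega>. ((\<Sum>i\<in>I. X i \<omega>) / n - l)\<^sup>2)
      = expectation (\<lambda>\<omega>. (\<Sum>i\<in>I. \<Sum>j\<in>I. X i \<omega> * X j \<omega>) / n\<^sup>2 - 2 * l / n * (\<Sum>i\<in>I. X i \<omega>) + l\<^sup>2)"
    by (simp add: power2_diff power_divide sum_product power2_eq_square[of "sum _ _"] mult_ac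
        diff_add_eq)
  also have "\<dots> = (\<Sum>i\<in>I. \<Sum>j\<in>I. expectation (\<lambda>\<omega>. X i \<omega> * X j \<omega>)) / n\<^sup>2 - 2 * l / n * (\<Sum>i\<in>I. a) + l\<^sup>2"
    using integrable_X integrable_XX mean by (simp add: prob_space)
  also have "\<dots> \<le> (n + n\<^sup>2 * b) / n\<^sup>2 - 2 * l / n * (\<Sum>i\<in>I. a) + l\<^sup>2"
    using square by (intro add_right_mono diff_right_mono divide_right_mono) auto
  also have "\<dots> = 1 / n + b - 2 * l * a + l\<^sup>2"
    using \<open>n > 0\<close> by (simp add: n_def[symmetric] add_divide_distrib power2_eq_square)
  finally show ?thesis
    by (simp add: n_def)
qed

subsection \<open>Convergence in probability\<close>

lemma tendsto_measure_zero_mono: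
  assumes "\<forall>\<^sub>F n in F. finite_measure (M n)"
    and "\<forall>\<^sub>F n in F. A n \<subseteq> B n \<and> B n \<in> sets (M n)"
    and "((\<lambda>n. measure (M n) (B n)) \<longlongrightarrow> 0) F"
  shows "((\<lambda>n. measure (M n) (A n)) \<longlongrightarrow> 0) F"
proof (rule tendsto_sandwich[OF _ _ tendsto_const assms(3)])
  show "\<forall>\<^sub>F n in F. measure (M n) (A n) \<le> measure (M n) (B n)"
    using assms(1,2) by eventually_elim (blast intro: finite_measure.finite_measure_mono)
qed simp

lemma tendsto_in_probabilityD:
  assumes "tendsto_in_probability M X c" "\<epsilon> > 0"
  shows "(\<lambda>n. measure (M n) {\<omega> \<in> space (M n). \<bar>X n \<omega> - c\<bar> > \<epsilon>}) \<longlonglongrightarrow> 0"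
  using assms by (simp add: tendsto_in_probability_def)

lemma tendsto_in_probability_const: "tendsto_in_probability M (\<lambda>n \<omega>. c) c"
  by (auto simp: tendsto_in_probability_def)

lemma tendsto_in_probability_cong:
  assumes "\<forall>\<^sub>F n in sequentially. \<forall>\<omega>. X n \<omega> = Y n \<omega>"
  shows "tendsto_in_probability M X c \<longleftrightarrow> tendsto_in_probability M Y c"
proof -
  have "(\<lambda>n. measure (M n) {\<omega> \<in> space (M n). \<bar>X n \<omega> - c\<bar> > \<epsilon>}) \<longlonglongrightarrow> 0 \<longleftrightarrow>
      (\<lambda>n. measure (M n) {\<omega> \<in> space (M n). \<bar>Y n \<omega> - c\<bar> > \<epsilon>}) \<longlonglongrightarrow> 0" for \<epsilon>
    by (rule tendsto_cong) (use assms in eventually_elim, simp)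
  then show ?thesis
    by (simp add: tendsto_in_probability_def)
qed

lemma tendsto_in_probability_cmult:
  assumes "tendsto_in_probability M X c"
  shows "tendsto_in_probability M (\<lambda>n \<omega>. a * X n \<omega>) (a * c)"
proof (cases "a = 0")
  case False
  have "\<epsilon> < \<bar>a * x - a * c\<bar> \<longleftrightarrow> \<epsilon> / \<bar>a\<bar> < \<bar>x - c\<bar>" for \<epsilon> x
  proof -
    have "\<bar>a * x - a * c\<bar> = \<bar>x - c\<bar> * \<bar>a\<bar>"
      by (metis abs_mult mult.commute right_diff_distrib)
    then show ?thesis
      using False by (simp add: pos_divide_less_eq)
  qed
  then show ?thesis
    using assms False by (simp add: tendsto_in_probability_def)
qed (simp add: tendsto_in_probability_const)

lemma tendsto_in_probability_add:
  assumes fin: "\<forall>\<^sub>F n in sequentially. finite_measure (M n)"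
    and [measurable]: "\<And>n. X n \<in> borel_measurable (M n)" "\<And>n. Y n \<in> borel_measurable (M n)"
    and lim_X: "tendsto_in_probability M X c" and lim_Y: "tendsto_in_probability M Y d"
  shows "tendsto_in_probability M (\<lambda>n \<omega>. X n \<omega> + Y n \<omega>) (c + d)"
  unfolding tendsto_in_probability_def
proof (intro allI impI)
  fix \<epsilon> :: real assume "\<epsilon> > 0"
  let ?A = "\<lambda>n. {\<omega> \<in> space (M n). \<bar>X n \<omega> - c\<bar> > \<epsilon> / 2}"
  let ?B = "\<lambda>n. {\<omega> \<in> space (M n). \<bar>Y n \<omega> - d\<bar> > \<epsilon> / 2}"
  have "(\<lambda>n. measure (M n) (?A n) + measure (M n) (?B n)) \<longlonglongrightarrow> 0 + 0"
    using \<open>\<epsilon> > 0\<close>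
    by (intro tendsto_add tendsto_in_probabilityD[OF lim_X] tendsto_in_probabilityD[OF lim_Y]) auto
  then have "(\<lambda>n. measure (M n) (?A n) + measure (M n) (?B n)) \<longlonglongrightarrow> 0"
    by simp
  moreover have "\<forall>\<^sub>F n in sequentially. norm (measure (M n) (?A n \<union> ?B n))
      \<le> measure (M n) (?A n) + measure (M n) (?B n)"
    unfolding real_norm_def abs_of_nonneg[OF measure_nonneg]
    by (intro always_eventually allI measure_Un_le) measurable
  ultimately have lim: "(\<lambda>n. measure (M n) (?A n \<union> ?B n)) \<longlonglongrightarrow> 0"
    by (rule Lim_null_comparison[rotated])
  have "\<bar>x - c\<bar> > \<epsilon> / 2 \<or> \<bar>y - d\<bar> > \<epsilon> / 2" if "\<bar>x + y - (c + d)\<bar> > \<epsilon>" for x y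
    using that by linarith
  then have "{\<omega> \<in> space (M n). \<bar>X n \<omega> + Y n \<omega> - (c + d)\<bar> > \<epsilon>} \<subseteq> ?A n \<union> ?B n" for n
    by blast
  then show "(\<lambda>n. measure (M n) {\<omega> \<in> space (M n). \<bar>X n \<omega> + Y n \<omega> - (c + d)\<bar> > \<epsilon>}) \<longlonglongrightarrow> 0"
    by (intro tendsto_measure_zero_mono[OF fin _ lim] always_eventually allI conjI) measurable
qed

lemma tendsto_in_probability_sum:
  assumes fin: "\<forall>\<^sub>F n in sequentially. finite_measure (M n)"
    and [measurable]: "\<And>i n. X i n \<in> borel_measurable (M n)"
    and lim: "\<And>i. i \<in> I \<Longrightarrow> tendsto_in_probability M (X i) (c i)"
  shows "tendsto_in_probability M (\<lambda>n \<omega>. \<Sum>i\<in>I. X i n \<omega>) (\<Sum>i\<in>I. c i)"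
  using lim
proof (induction I rule: infinite_finite_induct)
  case (insert i I)
  then have "tendsto_in_probability M (\<lambda>n \<omega>. X i n \<omega> + (\<Sum>j\<in>I. X j n \<omega>)) (c i + (\<Sum>j\<in>I. c j))"
    by (intro tendsto_in_probability_add[OF fin]) auto
  then show ?case
    using insert.hyps by simp
qed (simp_all add: tendsto_in_probability_const)

lemma tendsto_in_probability_approx:
  assumes fin: "\<forall>\<^sub>F n in sequentially. finite_measure (M n)"
    and approx: "\<And>\<epsilon>. \<epsilon> > 0 \<Longrightarrow>
      \<exists>Y d. tendsto_in_probability M Y d \<and> (\<forall>n. Y n \<in> borel_measurable (M n)) \<and>
        (\<forall>n \<omega>. \<bar>X n \<omega> - Y n \<omega>\<bar> \<le> \<epsilon>) \<and> \<bar>c - d\<bar> \<le> \<epsilon>"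
  shows "tendsto_in_probability M X c"
  unfolding tendsto_in_probability_def
proof (intro allI impI)
  fix \<epsilon> :: real assume "\<epsilon> > 0"
  then obtain Y d where lim_Y: "tendsto_in_probability M Y d"
    and [measurable]: "\<And>n. Y n \<in> borel_measurable (M n)"
    and close: "\<And>n \<omega>. \<bar>X n \<omega> - Y n \<omega>\<bar> \<le> \<epsilon> / 3" "\<bar>c - d\<bar> \<le> \<epsilon> / 3"
    using approx[of "\<epsilon> / 3"] by auto
  have "\<bar>Y n \<omega> - d\<bar> > \<epsilon> / 3" if "\<bar>X n \<omega> - c\<bar> > \<epsilon>" for n \<omega>
    using that close(1)[of n \<omega>] close(2) by linarith
  then have "{\<omega> \<in> space (M n). \<bar>X n \<omega> - c\<bar> > \<epsilon>} \<subseteq> {\<omega> \<in> space (M n). \<bar>Y n \<omega> - d\<bar> > \<epsilon> / 3}" for n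
    by blast
  moreover have "{\<omega> \<in> space (M n). \<bar>Y n \<omega> - d\<bar> > \<epsilon> / 3} \<in> sets (M n)" for n
    by measurable
  moreover have "\<epsilon> / 3 > 0"
    using \<open>\<epsilon> > 0\<close> by simp
  ultimately show "(\<lambda>n. measure (M n) {\<omega> \<in> space (M n). \<bar>X n \<omega> - c\<bar> > \<epsilon>}) \<longlonglongrightarrow> 0"
    by (intro tendsto_measure_zero_mono[OF fin _ tendsto_in_probabilityD[OF lim_Y]]
        always_eventually allI conjI)
qed

lemma tendsto_in_probability_if_mean_square:
  assumes fin: "\<forall>\<^sub>F n in sequentially. finite_measure (M n)"
    and [measurable]: "\<And>n. X n \<in> borel_measurable (M n)"
    and integrable: "\<forall>\<^sub>F n in sequentially. integrable (M n) (\<lambda>\<omega>. (X n \<omega> - c)\<^sup>2)"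
    and lim: "(\<lambda>n. \<integral>\<omega>. (X n \<omega> - c)\<^sup>2 \<partial>M n) \<longlonglongrightarrow> 0"
  shows "tendsto_in_probability M X c"
  unfolding tendsto_in_probability_def
proof (intro allI impI)
  fix \<epsilon> :: real assume "\<epsilon> > 0"
  let ?A = "\<lambda>n. {\<omega> \<in> space (M n). \<epsilon> \<le> \<bar>X n \<omega> - c\<bar>}"
  have "\<forall>\<^sub>F n in sequentially. norm (measure (M n) (?A n)) \<le> (\<integral>\<omega>. (X n \<omega> - c)\<^sup>2 \<partial>M n) / \<epsilon>\<^sup>2"
    using fin integrable
  proof eventually_elim
    case (elim n)
    then interpret finite_measure "M n"
      by simp
    show ?case
      unfolding real_norm_def abs_of_nonneg[OF measure_nonneg]
      using elim \<open>\<epsilon> > 0\<close> by (intro second_moment_method) auto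
  qed
  moreover have "(\<lambda>n. (\<integral>\<omega>. (X n \<omega> - c)\<^sup>2 \<partial>M n) / \<epsilon>\<^sup>2) \<longlonglongrightarrow> 0"
    using tendsto_divide[OF lim tendsto_const, of "\<epsilon>\<^sup>2"] \<open>\<epsilon> > 0\<close> by simp
  ultimately have lim_A: "(\<lambda>n. measure (M n) (?A n)) \<longlonglongrightarrow> 0"
    by (rule Lim_null_comparison)
  have "{\<omega> \<in> space (M n). \<bar>X n \<omega> - c\<bar> > \<epsilon>} \<subseteq> ?A n" for n
    by auto
  then show "(\<lambda>n. measure (M n) {\<omega> \<in> space (M n). \<bar>X n \<omega> - c\<bar> > \<epsilon>}) \<longlonglongrightarrow> 0"
    by (intro tendsto_measure_zero_mono[OF fin _ lim_A] always_eventually allI conjI) measurable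
qed

subsection \<open>Probability generating functions\<close>

definition pgf :: "nat pmf \<Rightarrow> real \<Rightarrow> real" where
  "pgf p s = measure_pmf.expectation p (\<lambda>d. s ^ d)"

lemma pgf_bounds: "s \<in> {0..1} \<Longrightarrow> pgf p s \<in> {0..1}"
  unfolding pgf_def by (intro measure_pmf.expectation_in_unit_interval power_in_unit_interval)

lemma continuous_extension_indicator_half_powers:
  fixes k :: nat
  obtains g :: "real \<Rightarrow> real"
  where "continuous_on {0..1} g" "\<And>d :: nat. g ((1 / 2) ^ d) = indicator {k} d"
proof
  let ?g = "\<lambda>x :: real. max 0 (1 - 2 ^ (k + 1) * \<bar>x - (1 / 2) ^ k\<bar>)"
  show "continuous_on {0..1} ?g"
    by (intro continuous_intros)
  show "?g ((1 / 2) ^ d) = indicator {k} d" for d :: nat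
  proof (cases "d = k")
    case False
    have half: "(1 / 2 :: real) ^ (k + 1) = (1 / 2) ^ k / 2"
      by simp
    have "(1 / 2) ^ (k + 1) \<le> \<bar>(1 / 2) ^ d - (1 / 2 :: real) ^ k\<bar>"
    proof (cases "d < k")
      case True
      then have "(1 / 2 :: real) ^ k \<le> (1 / 2) ^ (d + 1)"
        by (intro power_decreasing) auto
      then have "2 * (1 / 2 :: real) ^ k \<le> (1 / 2) ^ d"
        by simp
      then show ?thesis
        using half zero_le_power[of "1 / 2 :: real" k] by linarith
    next
      case False
      then have "(1 / 2 :: real) ^ d \<le> (1 / 2) ^ (k + 1)"
        using \<open>d \<noteq> k\<close> by (intro power_decreasing) auto
      then show ?thesis
        using half by linarith
    qed
    then have "1 \<le> 2 ^ (k + 1) * \<bar>(1 / 2) ^ d - (1 / 2 :: real) ^ k\<bar>"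
      by (simp add: power_one_over divide_le_eq mult.commute)
    then show ?thesis
      using False by simp
  qed simp
qed

lemma indicator_approx_powers:
  fixes k :: nat and \<epsilon> :: real
  assumes "\<epsilon> > 0"
  obtains a n where "\<And>d :: nat. \<bar>(\<Sum>j\<le>n. a j * ((1 / 2) ^ j) ^ d) - indicator {k} d\<bar> \<le> \<epsilon>"
proof -
  obtain g :: "real \<Rightarrow> real" where "continuous_on {0..1} g"
    and g_power: "\<And>d :: nat. g ((1 / 2) ^ d) = indicator {k} d"
    using continuous_extension_indicator_half_powers[of k] by blast
  from Stone_Weierstrass_real_polynomial_function[OF compact_Icc this(1) assms]
  obtain p where p_close: "real_polynomial_function p" "\<And>x. x \<in> {0..1} \<Longrightarrow> \<bar>g x - p x\<bar> < \<epsilon>"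
    by blast
  obtain a n where p_eq: "p = (\<lambda>x. \<Sum>j\<le>n. a j * x ^ j)"
    using p_close(1) real_polynomial_function_iff_sum by blast
  have "\<bar>(\<Sum>j\<le>n. a j * ((1 / 2) ^ j) ^ d) - indicator {k} d\<bar> \<le> \<epsilon>" for d :: nat
  proof -
    have "\<bar>g ((1 / 2) ^ d) - p ((1 / 2) ^ d)\<bar> < \<epsilon>"
      by (intro p_close(2)) (simp add: power_le_one)
    then show ?thesis
      by (simp add: g_power p_eq abs_minus_commute power_mult[symmetric] mult.commute)
  qed
  then show ?thesis
    by (rule that)
qed

lemma pmf_approx_pgf:
  assumes approx: "\<And>d. \<bar>(\<Sum>j\<le>n. a j * s j ^ d) - indicator {k} d\<bar> \<le> \<epsilon>"
    and s_bounds: "\<And>j. s j \<in> {0..1}"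
  shows "\<bar>(\<Sum>j\<le>n. a j * pgf p (s j)) - pmf p k\<bar> \<le> \<epsilon>"
proof -
  have integrable_power: "integrable p (\<lambda>d. a j * s j ^ d)" for j
    by (intro integrable_mult_right measure_pmf.integrable_unit_interval
        power_in_unit_interval s_bounds) simp
  have integrable_indicator: "integrable p (indicator {k} :: nat \<Rightarrow> real)"
    by (intro measure_pmf.integrable_unit_interval) (auto simp: indicator_def)
  have "(\<Sum>j\<le>n. a j * pgf p (s j)) - pmf p k
      = measure_pmf.expectation p (\<lambda>d. (\<Sum>j\<le>n. a j * s j ^ d) - indicator {k} d)"
    using integrable_power integrable_indicator
    by (subst Bochner_Integration.integral_diff) (auto simp: pgf_def measure_pmf_single)
  also have "\<bar>\<dots>\<bar> \<le> measure_pmf.expectation p (\<lambda>d. \<bar>(\<Sum>j\<le>n. a j * s j ^ d) - indicator {k} d\<bar>)"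
    by (rule integral_abs_bound)
  also have "\<dots> \<le> measure_pmf.expectation p (\<lambda>_. \<epsilon>)"
    using integrable_power integrable_indicator approx
    by (intro integral_mono integrable_abs Bochner_Integration.integrable_diff
        Bochner_Integration.integrable_sum) auto
  finally show ?thesis
    by simp
qed

lemma tendsto_in_probability_pmf_if_pgf:
  fixes D :: "nat \<Rightarrow> 'a \<Rightarrow> nat pmf"
  assumes fin: "\<forall>\<^sub>F n in sequentially. finite_measure (M n)"
    and [measurable]: "\<And>n s. (\<lambda>\<omega>. pgf (D n \<omega>) s) \<in> borel_measurable (M n)"
    and lim: "\<And>s. s \<in> {0..1} \<Longrightarrow> tendsto_in_probability M (\<lambda>n \<omega>. pgf (D n \<omega>) s) (pgf q s)"
  shows "tendsto_in_probability M (\<lambda>n \<omega>. pmf (D n \<omega>) k) (pmf q k)"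
proof (rule tendsto_in_probability_approx[OF fin])
  fix \<epsilon> :: real assume "\<epsilon> > 0"
  then obtain a n where approx: "\<And>d. \<bar>(\<Sum>j\<le>n. a j * ((1 / 2) ^ j) ^ d) - indicator {k} d\<bar> \<le> \<epsilon>"
    using indicator_approx_powers[of \<epsilon> k] by blast
  define P where "P = (\<lambda>p. \<Sum>j\<le>n. a j * pgf p ((1 / 2) ^ j))"
  have half: "(1 / 2 :: real) ^ j \<in> {0..1}" for j
    by (intro power_in_unit_interval) simp
  have "\<bar>P p - pmf p k\<bar> \<le> \<epsilon>" for p
    unfolding P_def by (rule pmf_approx_pgf[OF approx half])
  then have "\<bar>pmf p k - P p\<bar> \<le> \<epsilon>" for p
    by (simp add: abs_minus_commute)
  moreover have "tendsto_in_probability M (\<lambda>m \<omega>. P (D m \<omega>)) (P q)"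
    unfolding P_def
    by (intro tendsto_in_probability_sum tendsto_in_probability_cmult lim half fin) measurable
  moreover have "(\<lambda>\<omega>. P (D m \<omega>)) \<in> borel_measurable (M m)" for m
    unfolding P_def by measurable
  ultimately show "\<exists>Y d. tendsto_in_probability M Y d \<and> (\<forall>m. Y m \<in> borel_measurable (M m)) \<and>
      (\<forall>m \<omega>. \<bar>pmf (D m \<omega>) k - Y m \<omega>\<bar> \<le> \<epsilon>) \<and> \<bar>pmf q k - d\<bar> \<le> \<epsilon>"
    by blast
qed

subsection \<open>Mixed Poisson distributions\<close>

definition poisson_weight :: "real \<Rightarrow> nat \<Rightarrow> real" where
  "poisson_weight l k = exp (- l) * l ^ k / fact k"

definition mixed_poisson_pmf :: "'a measure \<Rightarrow> ('a \<Rightarrow> real) \<Rightarrow> nat pmf" where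
  "mixed_poisson_pmf M l = embed_pmf (\<lambda>k. \<integral>\<omega>. poisson_weight (l \<omega>) k \<partial>M)"

lemma poisson_weight_measurable [measurable]: "(\<lambda>l. poisson_weight l k) \<in> borel_measurable borel"
  unfolding poisson_weight_def by measurable

lemma poisson_weight_bounds:
  assumes "0 \<le> l"
  shows "poisson_weight l k \<in> {0..1}"
  using assms pmf_le_1[of "poisson_pmf l" k]
  by (cases "l = 0") (auto simp: poisson_weight_def mult_ac power_0_left)

lemma poisson_pgf_sums:
  fixes l s :: real
  shows "(\<lambda>k. poisson_weight l k * s ^ k) sums exp (- ((1 - s) * l))"
proof -
  have "(\<lambda>k. exp (- l) * ((l * s) ^ k /\<^sub>R fact k)) sums (exp (- l) * exp (l * s))"
    by (intro sums_mult exp_converges)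
  moreover have "exp (- l) * exp (l * s) = exp (- ((1 - s) * l))"
    by (simp add: algebra_simps flip: exp_add)
  ultimately show ?thesis
    by (simp add: poisson_weight_def power_mult_distrib divide_inverse mult_ac)
qed

context prob_space
begin

context
  fixes l :: "'a \<Rightarrow> real"
  assumes [measurable]: "l \<in> borel_measurable M" and l_nonneg: "\<And>\<omega>. 0 \<le> l \<omega>"
begin

lemma mixed_poisson_weights_suminf:
  assumes "0 \<le> s"
  shows "(\<Sum>k. ennreal (expectation (\<lambda>\<omega>. poisson_weight (l \<omega>) k)) * ennreal (s ^ k))
    = (\<integral>\<^sup>+\<omega>. ennreal (exp (- ((1 - s) * l \<omega>))) \<partial>M)"
proof -
  have "ennreal (expectation (\<lambda>\<omega>. poisson_weight (l \<omega>) k)) * ennreal (s ^ k)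
      = (\<integral>\<^sup>+\<omega>. ennreal (poisson_weight (l \<omega>) k * s ^ k) \<partial>M)" for k
  proof -
    have "ennreal (expectation (\<lambda>\<omega>. poisson_weight (l \<omega>) k))
        = (\<integral>\<^sup>+\<omega>. ennreal (poisson_weight (l \<omega>) k) \<partial>M)"
      using poisson_weight_bounds[OF l_nonneg]
      by (intro nn_integral_eq_integral[symmetric] integrable_unit_interval) auto
    then show ?thesis
      using poisson_weight_bounds[OF l_nonneg] assms by (simp add: ennreal_mult nn_integral_multc)
  qed
  moreover have "(\<Sum>k. \<integral>\<^sup>+\<omega>. ennreal (poisson_weight (l \<omega>) k * s ^ k) \<partial>M)
      = (\<integral>\<^sup>+\<omega>. (\<Sum>k. ennreal (poisson_weight (l \<omega>) k * s ^ k)) \<partial>M)"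
    by (intro nn_integral_suminf[symmetric]) auto
  moreover have "(\<Sum>k. ennreal (poisson_weight (l \<omega>) k * s ^ k))
      = ennreal (exp (- ((1 - s) * l \<omega>)))" for \<omega>
    using poisson_weight_bounds[OF l_nonneg] assms
    by (intro suminf_ennreal_eq poisson_pgf_sums) auto
  ultimately show ?thesis
    by simp
qed

lemma pmf_mixed_poisson_pmf:
  "pmf (mixed_poisson_pmf M l) k = expectation (\<lambda>\<omega>. poisson_weight (l \<omega>) k)"
  unfolding mixed_poisson_pmf_def
proof (rule pmf_embed_pmf)
  show "0 \<le> expectation (\<lambda>\<omega>. poisson_weight (l \<omega>) k)" for k
    using expectation_in_unit_interval[of "\<lambda>\<omega>. poisson_weight (l \<omega>) k"]
      poisson_weight_bounds[OF l_nonneg]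
    by simp
  show "(\<integral>\<^sup>+k. ennreal (expectation (\<lambda>\<omega>. poisson_weight (l \<omega>) k)) \<partial>count_space UNIV) = 1"
    using mixed_poisson_weights_suminf[of 1]
    by (simp add: nn_integral_count_space_nat emeasure_space_1)
qed

lemma pgf_mixed_poisson_pmf:
  assumes "0 \<le> s"
  shows "pgf (mixed_poisson_pmf M l) s = expectation (\<lambda>\<omega>. exp (- ((1 - s) * l \<omega>)))"
proof -
  have "(\<integral>\<^sup>+k. ennreal (s ^ k) \<partial>mixed_poisson_pmf M l)
      = (\<integral>\<^sup>+\<omega>. ennreal (exp (- ((1 - s) * l \<omega>))) \<partial>M)"
    using mixed_poisson_weights_suminf[OF assms]
    by (simp add: nn_integral_measure_pmf nn_integral_count_space_nat pmf_mixed_poisson_pmf)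
  then show ?thesis
    using assms by (simp add: pgf_def integral_eq_nn_integral)
qed

end

end

subsection \<open>Connection kernels on independent points\<close>

lemma (in prob_space) integral_PiM_prod_Diff:
  fixes h :: "('i \<Rightarrow> 'a) \<Rightarrow> 'a \<Rightarrow> real"
  assumes "finite I" "U \<subseteq> I"
    and [measurable]: "(\<lambda>(x, y). h x y) \<in> borel_measurable (PiM U (\<lambda>_. M) \<Otimes>\<^sub>M M)"
    and h_bounds: "\<And>x y. h x y \<in> {0..1}"
  shows "(\<integral>x. (\<Prod>w\<in>I - U. h (restrict x U) (x w)) \<partial>PiM I (\<lambda>_. M))
    = (\<integral>x. (\<integral>y. h x y \<partial>M) ^ card (I - U) \<partial>PiM U (\<lambda>_. M))"
proof -
  interpret product_sigma_finite "\<lambda>_ :: 'i. M"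
    by standard
  interpret PI: prob_space "PiM I (\<lambda>_. M)"
    by (intro prob_space_PiM prob_space_axioms)
  have finite: "finite U" "finite (I - U)" and I_eq: "U \<union> (I - U) = I"
    using assms finite_subset by auto
  have "(\<lambda>x. h (restrict x U) (x w)) \<in> borel_measurable (PiM I (\<lambda>_. M))" if "w \<in> I" for w
  proof -
    have "(\<lambda>x. (restrict x U, x w)) \<in> PiM I (\<lambda>_. M) \<rightarrow>\<^sub>M PiM U (\<lambda>_. M) \<Otimes>\<^sub>M M"
      using that assms
      by (intro measurable_Pair measurable_restrict_subset measurable_component_singleton)
    from measurable_compose[OF this assms(3)] show ?thesis
      by simp
  qed
  then have "integrable (PiM I (\<lambda>_. M)) (\<lambda>x. \<Prod>w\<in>I - U. h (restrict x U) (x w))"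
    by (intro PI.integrable_unit_interval prod_in_unit_interval h_bounds borel_measurable_prod) auto
  then have "(\<integral>x. (\<Prod>w\<in>I - U. h (restrict x U) (x w)) \<partial>PiM I (\<lambda>_. M))
     = (\<integral>x. (\<integral>y. (\<Prod>w\<in>I - U. h (restrict (merge U (I - U) (x, y)) U) (merge U (I - U) (x, y) w))
          \<partial>PiM (I - U) (\<lambda>_. M)) \<partial>PiM U (\<lambda>_. M))"
    using product_integral_fold[of U "I - U" "\<lambda>x. \<Prod>w\<in>I - U. h (restrict x U) (x w)"] finite
    unfolding I_eq by simp
  also have "\<dots> = (\<integral>x. (\<integral>y. (\<Prod>w\<in>I - U. h x (y w)) \<partial>PiM (I - U) (\<lambda>_. M)) \<partial>PiM U (\<lambda>_. M))"
  proof (intro Bochner_Integration.integral_cong prod.cong refl)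
    fix x :: "'i \<Rightarrow> 'a" and y w
    assume "x \<in> space (PiM U (\<lambda>_. M))" "w \<in> I - U"
    then show "h (restrict (merge U (I - U) (x, y)) U) (merge U (I - U) (x, y) w) = h x (y w)"
      by (simp add: space_PiM PiE_def extensional_restrict)
  qed
  also have "\<dots> = (\<integral>x. (\<integral>y. h x y \<partial>M) ^ card (I - U) \<partial>PiM U (\<lambda>_. M))"
  proof (rule Bochner_Integration.integral_cong[OF refl])
    fix x assume "x \<in> space (PiM U (\<lambda>_. M))"
    then have "integrable M (h x)"
      by (intro integrable_unit_interval h_bounds) measurable
    then show "(\<integral>y. (\<Prod>w\<in>I - U. h x (y w)) \<partial>PiM (I - U) (\<lambda>_. M)) = (\<integral>y. h x y \<partial>M) ^ card (I - U)"
      using product_integral_prod[of "I - U" "\<lambda>_. h x"] finite by simp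
  qed
  finally show ?thesis .
qed

lemma (in prob_space) distr_PiM_pair:
  assumes "u \<noteq> v"
  shows "distr (PiM {u, v} (\<lambda>_. M)) (M \<Otimes>\<^sub>M M) (\<lambda>x. (x u, x v)) = M \<Otimes>\<^sub>M M"
proof (rule pair_measure_eqI[symmetric])
  interpret product_sigma_finite "\<lambda>_. M"
    by standard
  have [measurable]: "(\<lambda>x. x u) \<in> PiM {u, v} (\<lambda>_. M) \<rightarrow>\<^sub>M M" "(\<lambda>x. x v) \<in> PiM {u, v} (\<lambda>_. M) \<rightarrow>\<^sub>M M"
    by (auto intro: measurable_component_singleton)
  fix A B assume [measurable]: "A \<in> sets M" "B \<in> sets M"
  let ?C = "\<lambda>i. if i = u then A else B"
  have "(\<lambda>x. (x u, x v)) -` (A \<times> B) \<inter> space (PiM {u, v} (\<lambda>_. M)) = PiE {u, v} ?C"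
    using assms sets.sets_into_space[of A M] sets.sets_into_space[of B M]
    by (auto simp: space_PiM PiE_iff)
  then have "emeasure (distr (PiM {u, v} (\<lambda>_. M)) (M \<Otimes>\<^sub>M M) (\<lambda>x. (x u, x v))) (A \<times> B)
      = emeasure (PiM {u, v} (\<lambda>_. M)) (PiE {u, v} ?C)"
    by (simp add: emeasure_distr)
  also have "\<dots> = (\<Prod>i\<in>{u, v}. emeasure M (?C i))"
    by (intro emeasure_PiM) auto
  finally show "emeasure M A * emeasure M B
      = emeasure (distr (PiM {u, v} (\<lambda>_. M)) (M \<Otimes>\<^sub>M M) (\<lambda>x. (x u, x v))) (A \<times> B)"
    using assms by simp
qed (auto intro: sigma_finite_measure_axioms)

lemma (in pair_sigma_finite) integral_fst_mult_snd:
  fixes f :: "'a \<Rightarrow> real" and g :: "'b \<Rightarrow> real"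
  assumes "integrable M1 f" "integrable M2 g"
  shows "(\<integral>z. f (fst z) * g (snd z) \<partial>(M1 \<Otimes>\<^sub>M M2)) = integral\<^sup>L M1 f * integral\<^sup>L M2 g"
proof -
  have "integrable (M1 \<Otimes>\<^sub>M M2) (\<lambda>z. f (fst z) * g (snd z))"
    using assms by (intro Fubini_integrable) (auto simp: abs_mult)
  from integral_fst'[OF this] show ?thesis
    by simp
qed

locale connection_kernel = prob_space M for M :: "'a measure" +
  fixes c :: "'a \<Rightarrow> 'a \<Rightarrow> real"
  assumes kernel_measurable: "(\<lambda>(x, y). c x y) \<in> borel_measurable (M \<Otimes>\<^sub>M M)"
    and kernel_bounds: "\<And>x y. c x y \<in> {0..1}"
    and kernel_commute: "\<And>x y. c x y = c y x"
begin

definition mean_kernel :: "'a \<Rightarrow> real" where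
  "mean_kernel x = (\<integral>y. c x y \<partial>M)"

definition mean_codegree :: "'a \<Rightarrow> 'a \<Rightarrow> real" where
  "mean_codegree x x' = (\<integral>y. c x y * c x' y \<partial>M)"

definition mean_avoid_pair :: "real \<Rightarrow> 'a \<Rightarrow> 'a \<Rightarrow> real" where
  "mean_avoid_pair \<sigma> x x' = (\<integral>y. (1 - \<sigma> * c x y) * (1 - \<sigma> * c x' y) \<partial>M)"

sublocale pair: pair_prob_space M M ..

lemma borel_measurable_kernel [measurable]:
  assumes [measurable]: "f \<in> N \<rightarrow>\<^sub>M M" "g \<in> N \<rightarrow>\<^sub>M M"
  shows "(\<lambda>x. c (f x) (g x)) \<in> borel_measurable N"
proof -
  have "(\<lambda>x. (f x, g x)) \<in> N \<rightarrow>\<^sub>M M \<Otimes>\<^sub>M M"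
    by measurable
  from measurable_compose[OF this kernel_measurable] show ?thesis
    by simp
qed

lemma mean_kernel_measurable [measurable]: "mean_kernel \<in> borel_measurable M"
  unfolding mean_kernel_def[abs_def] by measurable

lemma mean_codegree_measurable [measurable]:
  assumes [measurable]: "f \<in> N \<rightarrow>\<^sub>M M" "g \<in> N \<rightarrow>\<^sub>M M"
  shows "(\<lambda>x. mean_codegree (f x) (g x)) \<in> borel_measurable N"
  unfolding mean_codegree_def by measurable

lemma mean_avoid_pair_measurable [measurable]:
  assumes [measurable]: "f \<in> N \<rightarrow>\<^sub>M M" "g \<in> N \<rightarrow>\<^sub>M M"
  shows "(\<lambda>x. mean_avoid_pair \<sigma> (f x) (g x)) \<in> borel_measurable N"
  unfolding mean_avoid_pair_def by measurable

lemma mean_kernel_bounds: "mean_kernel x \<in> {0..1}"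
  unfolding mean_kernel_def by (intro expectation_in_unit_interval kernel_bounds)

lemma mean_codegree_bounds: "mean_codegree x x' \<in> {0..1}"
  unfolding mean_codegree_def
  by (intro expectation_in_unit_interval mult_in_unit_interval kernel_bounds)

lemma one_minus_kernel_bounds: "\<sigma> \<in> {0..1} \<Longrightarrow> 1 - \<sigma> * c x y \<in> {0..1}"
  by (intro unit_interval_intros kernel_bounds)

lemma mean_avoid_pair_bounds: "\<sigma> \<in> {0..1} \<Longrightarrow> mean_avoid_pair \<sigma> x x' \<in> {0..1}"
  unfolding mean_avoid_pair_def
  by (intro expectation_in_unit_interval mult_in_unit_interval one_minus_kernel_bounds)

lemma integrable_kernel: "x \<in> space M \<Longrightarrow> integrable M (c x)"
  by (intro integrable_unit_interval kernel_bounds) measurable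

lemma integral_mean_codegree:
  "(\<integral>z. mean_codegree (fst z) (snd z) \<partial>(M \<Otimes>\<^sub>M M)) = (\<integral>y. (mean_kernel y)\<^sup>2 \<partial>M)"
proof -
  interpret triple: pair_prob_space "M \<Otimes>\<^sub>M M" M ..
  have "(\<integral>z. mean_codegree (fst z) (snd z) \<partial>(M \<Otimes>\<^sub>M M))
      = (\<integral>y. (\<integral>z. c (fst z) y * c (snd z) y \<partial>(M \<Otimes>\<^sub>M M)) \<partial>M)"
    unfolding mean_codegree_def
  proof (rule triple.Fubini_integral[symmetric])
    show "integrable ((M \<Otimes>\<^sub>M M) \<Otimes>\<^sub>M M) (\<lambda>(z, y). c (fst z) y * c (snd z) y)"
      unfolding case_prod_unfold
      by (intro triple.P.integrable_unit_interval mult_in_unit_interval kernel_bounds) measurable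
  qed
  also have "\<dots> = (\<integral>y. (mean_kernel y)\<^sup>2 \<partial>M)"
  proof (rule Bochner_Integration.integral_cong[OF refl])
    fix y assume "y \<in> space M"
    then show "(\<integral>z. c (fst z) y * c (snd z) y \<partial>(M \<Otimes>\<^sub>M M)) = (mean_kernel y)\<^sup>2"
      using pair.integral_fst_mult_snd[OF integrable_kernel integrable_kernel, of y y]
      by (simp add: mean_kernel_def power2_eq_square kernel_commute[of _ y])
  qed
  finally show ?thesis .
qed

lemma mean_avoid_pair_le:
  assumes "x \<in> space M" "x' \<in> space M" "\<sigma> \<in> {0..1}"
  shows "mean_avoid_pair \<sigma> x x'
    \<le> (1 - \<sigma> * mean_kernel x) * (1 - \<sigma> * mean_kernel x') + mean_codegree x x'"
proof -
  have codegree: "integrable M (\<lambda>y. c x y * c x' y)"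
    using assms by (intro integrable_unit_interval mult_in_unit_interval kernel_bounds) measurable
  have "mean_avoid_pair \<sigma> x x'
      = (\<integral>y. 1 - \<sigma> * c x y - \<sigma> * c x' y + \<sigma>\<^sup>2 * (c x y * c x' y) \<partial>M)"
    unfolding mean_avoid_pair_def
    by (intro Bochner_Integration.integral_cong) (auto simp: algebra_simps power2_eq_square)
  also have "\<dots> = 1 - \<sigma> * mean_kernel x - \<sigma> * mean_kernel x' + \<sigma>\<^sup>2 * mean_codegree x x'"
    using integrable_kernel[OF assms(1)] integrable_kernel[OF assms(2)] codegree
    by (simp add: mean_kernel_def mean_codegree_def prob_space)
  also have "\<dots> = (1 - \<sigma> * mean_kernel x) * (1 - \<sigma> * mean_kernel x')
      - \<sigma>\<^sup>2 * (mean_kernel x * mean_kernel x') + \<sigma>\<^sup>2 * mean_codegree x x'"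
    by (simp add: algebra_simps power2_eq_square)
  also have "\<dots> \<le> (1 - \<sigma> * mean_kernel x) * (1 - \<sigma> * mean_kernel x') - 0 + 1 * mean_codegree x x'"
    using assms(3) mean_kernel_bounds mean_codegree_bounds
    by (intro add_mono diff_mono mult_right_mono order_refl) (auto simp: power_le_one)
  finally show ?thesis
    by simp
qed

lemma integral_prod_avoid_vertex:
  assumes "finite I" "v \<in> I" "\<sigma> \<in> {0..1}"
  shows "(\<integral>x. (\<Prod>w\<in>I - {v}. 1 - \<sigma> * c (x v) (x w)) \<partial>PiM I (\<lambda>_. M))
    = (\<integral>x. (1 - \<sigma> * mean_kernel x) ^ (card I - 1) \<partial>M)"
proof -
  interpret product_sigma_finite "\<lambda>_. M"
    by standard
  have "(\<integral>x. (\<Prod>w\<in>I - {v}. 1 - \<sigma> * c (x v) (x w)) \<partial>PiM I (\<lambda>_. M))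
      = (\<integral>x. (\<integral>y. 1 - \<sigma> * c (x v) y \<partial>M) ^ card (I - {v}) \<partial>PiM {v} (\<lambda>_. M))"
    using integral_PiM_prod_Diff[of I "{v}" "\<lambda>x y. 1 - \<sigma> * c (x v) y"]
      assms one_minus_kernel_bounds[OF assms(3)]
    by simp
  also have "\<dots> = (\<integral>x. (\<integral>y. 1 - \<sigma> * c x y \<partial>M) ^ card (I - {v}) \<partial>M)"
    by (rule product_integral_singleton) measurable
  also have "\<dots> = (\<integral>x. (1 - \<sigma> * mean_kernel x) ^ (card I - 1) \<partial>M)"
    using assms
    by (intro Bochner_Integration.integral_cong)
      (auto simp: mean_kernel_def prob_space integrable_kernel)
  finally show ?thesis .
qed

lemma integral_power_mean_avoid_pair_le:
  assumes "\<sigma> \<in> {0..1}"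
  shows "(\<integral>z. mean_avoid_pair \<sigma> (fst z) (snd z) ^ n \<partial>(M \<Otimes>\<^sub>M M))
    \<le> (\<integral>x. (1 - \<sigma> * mean_kernel x) ^ n \<partial>M)\<^sup>2 + real n * (\<integral>x. (mean_kernel x)\<^sup>2 \<partial>M)"
proof -
  define b where "b = (\<lambda>x. 1 - \<sigma> * mean_kernel x)"
  have [measurable]: "b \<in> borel_measurable M"
    unfolding b_def by measurable
  have b_bounds: "b x \<in> {0..1}" for x
    unfolding b_def by (intro unit_interval_intros mean_kernel_bounds assms)
  have integrable_b: "integrable M (\<lambda>x. b x ^ n)"
    by (intro integrable_unit_interval unit_interval_intros b_bounds) measurable
  have integrable_bb: "integrable (M \<Otimes>\<^sub>M M) (\<lambda>z. b (fst z) ^ n * b (snd z) ^ n)"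
    by (intro pair.P.integrable_unit_interval unit_interval_intros b_bounds) measurable
  have integrable_codegree: "integrable (M \<Otimes>\<^sub>M M) (\<lambda>z. mean_codegree (fst z) (snd z))"
    by (intro pair.P.integrable_unit_interval mean_codegree_bounds) measurable
  have "(\<integral>z. mean_avoid_pair \<sigma> (fst z) (snd z) ^ n \<partial>(M \<Otimes>\<^sub>M M))
      \<le> (\<integral>z. b (fst z) ^ n * b (snd z) ^ n + real n * mean_codegree (fst z) (snd z) \<partial>(M \<Otimes>\<^sub>M M))"
  proof (rule integral_mono)
    show "integrable (M \<Otimes>\<^sub>M M) (\<lambda>z. mean_avoid_pair \<sigma> (fst z) (snd z) ^ n)"
      by (intro pair.P.integrable_unit_interval unit_interval_intros mean_avoid_pair_bounds assms)
        measurable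
    fix z assume "z \<in> space (M \<Otimes>\<^sub>M M)"
    then have "mean_avoid_pair \<sigma> (fst z) (snd z)
        \<le> b (fst z) * b (snd z) + mean_codegree (fst z) (snd z)"
      unfolding b_def using assms by (intro mean_avoid_pair_le) (auto simp: space_pair_measure)
    then have "mean_avoid_pair \<sigma> (fst z) (snd z) ^ n
        \<le> (b (fst z) * b (snd z)) ^ n + real n * mean_codegree (fst z) (snd z)"
      using mean_codegree_bounds[of "fst z" "snd z"]
      by (intro power_le_power_add mean_avoid_pair_bounds unit_interval_intros b_bounds assms) auto
    then show "mean_avoid_pair \<sigma> (fst z) (snd z) ^ n
        \<le> b (fst z) ^ n * b (snd z) ^ n + real n * mean_codegree (fst z) (snd z)"
      by (simp only: power_mult_distrib)
  qed (use integrable_bb integrable_codegree in auto)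
  also have "\<dots> = (\<integral>x. b x ^ n \<partial>M)\<^sup>2 + real n * (\<integral>x. (mean_kernel x)\<^sup>2 \<partial>M)"
    using integrable_bb integrable_codegree pair.integral_fst_mult_snd[OF integrable_b integrable_b]
    by (simp add: integral_mean_codegree power2_eq_square)
  finally show ?thesis
    by (simp add: b_def)
qed

lemma integral_prod_avoid_pair_le:
  assumes "finite I" "u \<in> I" "v \<in> I" "u \<noteq> v" "\<sigma> \<in> {0..1}"
  shows "(\<integral>x. (\<Prod>w\<in>I - {u, v}. (1 - \<sigma> * c (x u) (x w)) * (1 - \<sigma> * c (x v) (x w))) \<partial>PiM I (\<lambda>_. M))
    \<le> (\<integral>x. (1 - \<sigma> * mean_kernel x) ^ (card I - 2) \<partial>M)\<^sup>2 + card I * (\<integral>x. (mean_kernel x)\<^sup>2 \<partial>M)"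
proof -
  have [measurable]: "(\<lambda>x. x u) \<in> PiM {u, v} (\<lambda>_. M) \<rightarrow>\<^sub>M M" "(\<lambda>x. x v) \<in> PiM {u, v} (\<lambda>_. M) \<rightarrow>\<^sub>M M"
    by (auto intro: measurable_component_singleton)
  have "(\<integral>x. (\<Prod>w\<in>I - {u, v}. (1 - \<sigma> * c (x u) (x w)) * (1 - \<sigma> * c (x v) (x w))) \<partial>PiM I (\<lambda>_. M))
      = (\<integral>x. mean_avoid_pair \<sigma> (x u) (x v) ^ card (I - {u, v}) \<partial>PiM {u, v} (\<lambda>_. M))"
    using integral_PiM_prod_Diff[of I "{u, v}" "\<lambda>x y. (1 - \<sigma> * c (x u) y) * (1 - \<sigma> * c (x v) y)"]
      assms mult_in_unit_interval[OF one_minus_kernel_bounds one_minus_kernel_bounds,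
        OF assms(5) assms(5)]
    by (simp add: mean_avoid_pair_def)
  also have "\<dots> = (\<integral>z. mean_avoid_pair \<sigma> (fst z) (snd z) ^ (card I - 2) \<partial>(M \<Otimes>\<^sub>M M))"
    using assms
    by (subst distr_PiM_pair[OF assms(4), symmetric])
      (simp add: integral_distr card_Diff_subset numeral_2_eq_2)
  also have "\<dots> \<le> (\<integral>x. (1 - \<sigma> * mean_kernel x) ^ (card I - 2) \<partial>M)\<^sup>2
      + real (card I - 2) * (\<integral>x. (mean_kernel x)\<^sup>2 \<partial>M)"
    by (rule integral_power_mean_avoid_pair_le[OF assms(5)])
  also have "\<dots>
      \<le> (\<integral>x. (1 - \<sigma> * mean_kernel x) ^ (card I - 2) \<partial>M)\<^sup>2 + card I * (\<integral>x. (mean_kernel x)\<^sup>2 \<partial>M)"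
    by (intro add_left_mono mult_right_mono Bochner_Integration.integral_nonneg) auto
  finally show ?thesis .
qed

end

subsection \<open>Connection probabilities near the boundary of the disc\<close>

lemma sin_ge_two_div_pi:
  fixes x :: real
  assumes "0 \<le> x" "x \<le> pi / 2"
  shows "2 * x / pi \<le> sin x"
proof -
  have "convex_on {0..pi / 2} (\<lambda>x. - sin x)"
  proof (rule f''_ge0_imp_convex)
    show "((\<lambda>x. - sin x) has_real_derivative - cos x) (at x)" for x :: real
      by (auto intro!: derivative_eq_intros)
    show "((\<lambda>x. - cos x) has_real_derivative sin x) (at x)" for x :: real
      by (auto intro!: derivative_eq_intros)
  qed (auto intro!: sin_ge_zero)
  from convex_onD[OF this, of "2 * x / pi" 0 "pi / 2"] show ?thesis
    using assms by (auto simp: field_simps)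
qed

lemma cos_le_one_minus_square:
  fixes x :: real
  assumes "0 \<le> x" "x \<le> pi"
  shows "cos x \<le> 1 - (x / pi)\<^sup>2"
proof -
  have "x / pi \<le> sin (x / 2)"
    using sin_ge_two_div_pi[of "x / 2"] assms by simp
  then have "(x / pi)\<^sup>2 \<le> (sin (x / 2))\<^sup>2"
    using assms by (intro power_mono) auto
  moreover have "cos x = 1 - 2 * (sin (x / 2))\<^sup>2"
    using cos_double_sin[of "x / 2"] by simp
  ultimately show ?thesis
    using zero_le_power2[of "x / pi"] by linarith
qed

lemma relative_angle_bounds:
  assumes "\<bar>a - b\<bar> \<le> 2 * pi"
  shows "0 \<le> relative_angle a b" "relative_angle a b \<le> pi"
  using assms by (auto simp: relative_angle_def min_def)

lemma relative_angle_0_left: "0 \<le> \<theta> \<Longrightarrow> \<theta> \<le> pi \<Longrightarrow> relative_angle 0 \<theta> = \<theta>"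
  by (simp add: relative_angle_def)

lemma exp_add_le_cosh_mult_cosh: "exp (a + b) / 4 \<le> cosh a * cosh (b :: real)"
proof -
  have "exp a / 2 * (exp b / 2) \<le> cosh a * cosh b"
    by (intro mult_mono) (auto simp: cosh_def)
  then show ?thesis
    by (simp add: exp_add)
qed

lemma exp_hyp_dist_ge:
  assumes "\<zeta> > 0" "fst u \<ge> 0" "fst v \<ge> 0" "\<bar>snd u - snd v\<bar> \<le> 2 * pi"
  shows "(relative_angle (snd u) (snd v) / (2 * pi))\<^sup>2 * exp (\<zeta> * (fst u + fst v))
    \<le> exp (\<zeta> * hyp_dist \<zeta> u v)"
proof -
  define a b \<theta> where "a = \<zeta> * fst u" and "b = \<zeta> * fst v" and "\<theta> = relative_angle (snd u) (snd v)"
  have ab_nonneg: "a \<ge> 0" "b \<ge> 0"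
    using assms by (auto simp: a_def b_def)
  have \<theta>: "0 \<le> \<theta>" "\<theta> \<le> pi"
    unfolding \<theta>_def using relative_angle_bounds[OF assms(4)] by auto
  then have \<theta>_le_1: "(\<theta> / pi)\<^sup>2 \<le> 1"
    by (intro power_le_one) auto
  have "sinh a * sinh b * cos \<theta> \<le> sinh a * sinh b * (1 - (\<theta> / pi)\<^sup>2)"
    using ab_nonneg \<theta> by (intro mult_left_mono cos_le_one_minus_square) auto
  also have "\<dots> \<le> cosh a * cosh b * (1 - (\<theta> / pi)\<^sup>2)"
    using ab_nonneg \<theta>_le_1 by (intro mult_right_mono mult_mono sinh_le_cosh_real) auto
  finally have "cosh a * cosh b * (\<theta> / pi)\<^sup>2 \<le> cosh (\<zeta> * hyp_dist \<zeta> u v)"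
    using cosh_hyp_dist[of \<zeta> u v] assms by (simp add: a_def b_def \<theta>_def algebra_simps)
  moreover have "exp (a + b) / 4 * (\<theta> / pi)\<^sup>2 \<le> cosh a * cosh b * (\<theta> / pi)\<^sup>2"
    by (intro mult_right_mono exp_add_le_cosh_mult_cosh) auto
  moreover have "cosh (\<zeta> * hyp_dist \<zeta> u v) \<le> exp (\<zeta> * hyp_dist \<zeta> u v)"
    using hyp_dist_nonneg[of \<zeta> u v] assms by (simp add: cosh_def)
  ultimately show ?thesis
    by (simp add: a_def b_def \<theta>_def distrib_left power_divide power_mult_distrib mult.commute)
qed

lemma exp_half_square: "(exp (x / 2 :: real))\<^sup>2 = exp x"
  by (simp flip: exp_double)

lemma square_powr_half: "x \<ge> 0 \<Longrightarrow> x\<^sup>2 powr (b / 2) = x powr (b :: real)"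
  by (simp add: powr_powr flip: powr_numeral)

lemma connection_prob_eq_powr:
  "connection_prob \<zeta> \<beta> R u v
     = 1 / (1 + (exp (\<zeta> * hyp_dist \<zeta> u v) / exp (\<zeta> * R)) powr (\<beta> / 2))"
proof -
  have "\<beta> * (\<zeta> / 2) * (hyp_dist \<zeta> u v - R) = \<beta> / 2 * (\<zeta> * hyp_dist \<zeta> u v - \<zeta> * R)"
    by (simp add: right_diff_distrib diff_divide_distrib)
  then show ?thesis
    by (simp add: connection_prob_def powr_def ln_div add.commute)
qed

lemma connection_prob_le:
  assumes "\<zeta> > 0" "\<beta> > 0" "fst u \<ge> 0" "fst v \<ge> 0" "\<bar>snd u - snd v\<bar> \<le> 2 * pi"
  shows "connection_prob \<zeta> \<beta> R u v
    \<le> 1 / (1 + (exp (\<zeta> * (fst u + fst v - R) / 2) / (2 * pi)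
        * relative_angle (snd u) (snd v)) powr \<beta>)"
proof -
  define E where "E = exp (\<zeta> * hyp_dist \<zeta> u v) / exp (\<zeta> * R)"
  define x where "x = exp (\<zeta> * (fst u + fst v - R) / 2) / (2 * pi) * relative_angle (snd u) (snd v)"
  have "x \<ge> 0"
    using relative_angle_bounds[OF assms(5)] by (simp add: x_def)
  have "x\<^sup>2
      = (relative_angle (snd u) (snd v) / (2 * pi))\<^sup>2 * exp (\<zeta> * (fst u + fst v)) / exp (\<zeta> * R)"
    by (simp add: x_def power_mult_distrib power_divide exp_half_square)
      (simp add: right_diff_distrib exp_diff mult_ac)
  also have "\<dots> \<le> E"
    unfolding E_def using assms by (intro divide_right_mono exp_hyp_dist_ge) auto
  finally have "x\<^sup>2 powr (\<beta> / 2) \<le> E powr (\<beta> / 2)"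
    using assms by (intro powr_mono2) auto
  then have "x powr \<beta> \<le> E powr (\<beta> / 2)"
    using \<open>x \<ge> 0\<close> by (simp only: square_powr_half)
  then show ?thesis
    unfolding connection_prob_eq_powr E_def[symmetric] x_def[symmetric]
    by (intro divide_left_mono add_left_mono mult_pos_pos add_pos_nonneg) auto
qed

lemma filterlim_disc_radius: "\<zeta> > 0 \<Longrightarrow> filterlim (disc_radius \<zeta>) at_top sequentially"
  unfolding disc_radius_def by real_asymp

lemma exp_mult_disc_radius:
  assumes "\<zeta> > 0" "N > 0"
  shows "exp (\<zeta> * disc_radius \<zeta> N) = (real N)\<^sup>2"
  using exp_disc_radius[OF assms] exp_double[of "\<zeta> * disc_radius \<zeta> N / 2"] by simp

lemma tendsto_cosh_dist_near_boundary:
  assumes "\<zeta> > 0" "\<phi> > 0"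
  shows "(\<lambda>N. (cosh (\<zeta> * (disc_radius \<zeta> N - t)) * cosh (\<zeta> * (disc_radius \<zeta> N - s))
      - sinh (\<zeta> * (disc_radius \<zeta> N - t)) * sinh (\<zeta> * (disc_radius \<zeta> N - s))
        * cos (\<phi> / real N)) / (real N)\<^sup>2)
    \<longlonglongrightarrow> exp (- (\<zeta> * t)) * exp (- (\<zeta> * s)) * (\<phi> * \<phi>) / 8"
  unfolding disc_radius_def using assms by real_asymp

lemma tendsto_exp_hyp_dist_near_boundary:
  assumes "\<zeta> > 0" "\<phi> > 0"
  shows "(\<lambda>N. exp (\<zeta> * hyp_dist \<zeta> (disc_radius \<zeta> N - t, 0) (disc_radius \<zeta> N - s, \<phi> / real N))
            / exp (\<zeta> * disc_radius \<zeta> N)) \<longlonglongrightarrow> (\<phi> / 2 * exp (- \<zeta> * (t + s) / 2))\<^sup>2"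
proof (rule Lim_transform_eventually)
  define X where "X = (\<lambda>N. cosh (\<zeta> * (disc_radius \<zeta> N - t)) * cosh (\<zeta> * (disc_radius \<zeta> N - s))
      - sinh (\<zeta> * (disc_radius \<zeta> N - t)) * sinh (\<zeta> * (disc_radius \<zeta> N - s)) * cos (\<phi> / real N))"
  define L where "L = exp (- (\<zeta> * t)) * exp (- (\<zeta> * s)) * (\<phi> * \<phi>) / 8"
  have lim_X: "(\<lambda>N. X N / (real N)\<^sup>2) \<longlonglongrightarrow> L"
    unfolding X_def L_def by (rule tendsto_cosh_dist_near_boundary[OF assms])
  have "L > 0"
    using assms by (simp add: L_def)
  have "filterlim (\<lambda>N. (real N)\<^sup>2) at_top sequentially"
    by real_asymp
  from filterlim_tendsto_pos_mult_at_top[OF lim_X \<open>L > 0\<close> this]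
  have "filterlim (\<lambda>N. X N / (real N)\<^sup>2 * (real N)\<^sup>2) at_top sequentially" .
  moreover have "\<forall>\<^sub>F N in sequentially. X N / (real N)\<^sup>2 * (real N)\<^sup>2 = X N"
    using eventually_gt_at_top[of 0] by eventually_elim simp
  ultimately have X_at_top: "filterlim X at_top sequentially"
    using filterlim_cong by fast
  have "((\<lambda>x :: real. exp (arcosh x) / x) \<longlongrightarrow> 2) at_top"
    by real_asymp
  from tendsto_mult[OF filterlim_compose[OF this X_at_top] lim_X]
  have "(\<lambda>N. exp (arcosh (X N)) / X N * (X N / (real N)\<^sup>2)) \<longlonglongrightarrow> 2 * L" .
  also have "2 * L = (\<phi> / 2 * exp (- \<zeta> * (t + s) / 2))\<^sup>2"
    by (simp add: L_def power_mult_distrib power_divide exp_half_square)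
      (simp add: power2_eq_square algebra_simps flip: exp_add)
  finally show "(\<lambda>N. exp (arcosh (X N)) / X N * (X N / (real N)\<^sup>2))
      \<longlonglongrightarrow> (\<phi> / 2 * exp (- \<zeta> * (t + s) / 2))\<^sup>2" .
  have "\<forall>\<^sub>F N in sequentially. X N > 0"
    using X_at_top by (simp add: filterlim_at_top_dense)
  then show "\<forall>\<^sub>F N in sequentially. exp (arcosh (X N)) / X N * (X N / (real N)\<^sup>2)
      = exp (\<zeta> * hyp_dist \<zeta> (disc_radius \<zeta> N - t, 0) (disc_radius \<zeta> N - s, \<phi> / real N))
            / exp (\<zeta> * disc_radius \<zeta> N)"
    using eventually_gt_at_top[of 0]
    by eventually_elim
      (use assms in \<open>simp add: hyp_dist_def X_def cos_relative_angle exp_mult_disc_radius\<close>)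
qed

lemma tendsto_connection_prob_near_boundary:
  assumes "\<zeta> > 0" "\<beta> > 0" "\<phi> > 0"
  shows "(\<lambda>N. connection_prob \<zeta> \<beta> (disc_radius \<zeta> N)
      (disc_radius \<zeta> N - t, 0) (disc_radius \<zeta> N - s, \<phi> / real N))
    \<longlonglongrightarrow> 1 / (1 + (exp (- \<zeta> * (t + s) / 2) / 2 * \<phi>) powr \<beta>)"
proof -
  define x where "x = \<phi> / 2 * exp (- \<zeta> * (t + s) / 2)"
  have "x > 0"
    using assms by (simp add: x_def)
  then have "1 + (x\<^sup>2) powr (\<beta> / 2) \<noteq> 0"
    by (smt (verit) powr_ge_zero)
  then have "(\<lambda>N. connection_prob \<zeta> \<beta> (disc_radius \<zeta> N)
      (disc_radius \<zeta> N - t, 0) (disc_radius \<zeta> N - s, \<phi> / real N))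
    \<longlonglongrightarrow> 1 / (1 + (x\<^sup>2) powr (\<beta> / 2))"
    unfolding connection_prob_eq_powr x_def using assms
    by (intro tendsto_intros tendsto_exp_hyp_dist_near_boundary) auto
  then show ?thesis
    using \<open>x > 0\<close> by (simp add: square_powr_half x_def mult.commute)
qed

subsection \<open>The distance of a random point from the boundary\<close>

lemma radial_density_nonneg: "\<alpha> > 0 \<Longrightarrow> 0 \<le> radial_density \<alpha> R r"
  using cosh_real_ge_1[of "\<alpha> * R"] by (auto simp: radial_density_def)

lemma radial_density_eq_0: "t \<notin> {0..R} \<Longrightarrow> radial_density \<alpha> R (R - t) = 0"
  by (auto simp: radial_density_def)

lemma radial_density_le_exponential_density:
  assumes "\<alpha> > 0" "exp (- (\<alpha> * R)) \<le> 1 / 2"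
  shows "radial_density \<alpha> R (R - t) \<le> 4 * exponential_density \<alpha> t"
proof (cases "t \<in> {0..R}")
  case True
  define x where "x = exp (\<alpha> * R)"
  have "x \<ge> 2"
    using assms(2) by (simp add: x_def exp_minus field_simps)
  then have "x\<^sup>2 \<le> (2 * (x - 1))\<^sup>2"
    by (intro power_mono) auto
  then have "x / 8 \<le> (x - 1)\<^sup>2 / (2 * x)"
    using \<open>x \<ge> 2\<close> by (simp add: field_simps power2_eq_square)
  also have "\<dots> = cosh (\<alpha> * R) - 1"
    by (simp add: x_def cosh_field_def exp_minus field_simps power2_eq_square)
  finally have denominator: "x / 8 \<le> cosh (\<alpha> * R) - 1" .
  have numerator: "sinh (\<alpha> * (R - t)) \<le> x * exp (- (t * \<alpha>)) / 2"
    by (simp add: x_def sinh_field_def algebra_simps flip: exp_add)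
  have "\<alpha> * sinh (\<alpha> * (R - t)) / (cosh (\<alpha> * R) - 1) \<le> \<alpha> * (x * exp (- (t * \<alpha>)) / 2) / (x / 8)"
    using assms(1) \<open>x \<ge> 2\<close> by (intro frac_le mult_left_mono numerator denominator) auto
  then show ?thesis
    using True \<open>x \<ge> 2\<close> by (simp add: radial_density_def exponential_density_def)
next
  case False
  then show ?thesis
    using assms(1) by (simp add: radial_density_eq_0 exponential_density_nonneg)
qed

lemma eventually_radial_density_le_exponential_density:
  assumes "\<alpha> > 0"
  shows "\<forall>\<^sub>F R in at_top. \<forall>t. radial_density \<alpha> R (R - t) \<le> 4 * exponential_density \<alpha> t"
proof -
  have "\<forall>\<^sub>F R in at_top. exp (- (\<alpha> * R)) \<le> 1 / 2"
    using assms by real_asymp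
  then show ?thesis
    by eventually_elim (use assms radial_density_le_exponential_density in blast)
qed

lemma tendsto_radial_density:
  assumes "\<alpha> > 0"
  shows "((\<lambda>R. radial_density \<alpha> R (R - t)) \<longlongrightarrow> exponential_density \<alpha> t) at_top"
proof (cases "t \<ge> 0")
  case True
  have "((\<lambda>R. \<alpha> * sinh (\<alpha> * (R - t)) / (cosh (\<alpha> * R) - 1)) \<longlongrightarrow> \<alpha> * exp (- (\<alpha> * t))) at_top"
    using assms by real_asymp (simp add: exp_minus divide_inverse)
  moreover have "\<forall>\<^sub>F R in at_top. \<alpha> * sinh (\<alpha> * (R - t)) / (cosh (\<alpha> * R) - 1)
      = radial_density \<alpha> R (R - t)"
    using eventually_ge_at_top[of t] by eventually_elim (use True in \<open>simp add: radial_density_def\<close>)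
  ultimately show ?thesis
    using True by (auto intro: Lim_transform_eventually simp: exponential_density_def mult.commute)
qed (simp add: radial_density_def exponential_density_def)

lemma abs_radial_density_mult_le:
  assumes "\<alpha> > 0" "radial_density \<alpha> R (R - t) \<le> 4 * exponential_density \<alpha> t"
    and bound: "t \<in> {0..R} \<Longrightarrow> \<bar>y\<bar> \<le> C * exp (\<gamma> * t)"
  shows "\<bar>radial_density \<alpha> R (R - t) * y\<bar> \<le> 4 * \<bar>C\<bar> * (exponential_density \<alpha> t * exp (\<gamma> * t))"
proof (cases "t \<in> {0..R}")
  case True
  have "\<bar>radial_density \<alpha> R (R - t) * y\<bar> = radial_density \<alpha> R (R - t) * \<bar>y\<bar>"
    using assms(1) by (simp add: abs_mult radial_density_nonneg)
  also have "\<dots> \<le> 4 * exponential_density \<alpha> t * (\<bar>C\<bar> * exp (\<gamma> * t))"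
  proof (rule mult_mono)
    show "\<bar>y\<bar> \<le> \<bar>C\<bar> * exp (\<gamma> * t)"
      by (rule order_trans[OF bound[OF True] mult_right_mono[OF abs_ge_self]]) simp
  qed (use assms(1,2) in \<open>auto simp: exponential_density_nonneg\<close>)
  finally show ?thesis
    by (simp add: mult_ac)
next
  case False
  then show ?thesis
    using assms(1) by (simp add: radial_density_eq_0 exponential_density_nonneg)
qed

text \<open>Since \<open>\<gamma> < \<alpha>\<close>, the dominating function \<open>exponential_density \<alpha> t * exp (\<gamma> * t)\<close> is integrable.\<close>

lemma tendsto_integral_radial_density:
  fixes h :: "nat \<Rightarrow> real \<Rightarrow> real" and h_lim :: "real \<Rightarrow> real"
  assumes "\<alpha> > 0" "\<gamma> < \<alpha>" and R_at_top: "filterlim R at_top sequentially"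
    and [measurable]: "\<And>n. h n \<in> borel_measurable borel" "h_lim \<in> borel_measurable borel"
    and lim: "\<And>t. (\<lambda>n. h n t) \<longlonglongrightarrow> h_lim t"
    and bound: "\<forall>\<^sub>F n in sequentially. \<forall>t\<in>{0..R n}. \<bar>h n t\<bar> \<le> C * exp (\<gamma> * t)"
  shows "(\<lambda>n. \<integral>t. radial_density \<alpha> (R n) (R n - t) * h n t \<partial>lborel)
    \<longlonglongrightarrow> (\<integral>t. exponential_density \<alpha> t * h_lim t \<partial>lborel)"
proof (rule integral_dominated_convergence_eventually)
  let ?w = "\<lambda>t. 4 * \<bar>C\<bar> * (exponential_density \<alpha> t * exp (\<gamma> * t))"
  show "integrable lborel ?w"
    using integrable.intros[OF has_bochner_integral_exponential_density_mult_exp[OF assms(2)]]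
    by (rule integrable_mult_right)
  show "AE t in lborel. (\<lambda>n. radial_density \<alpha> (R n) (R n - t) * h n t)
      \<longlonglongrightarrow> exponential_density \<alpha> t * h_lim t"
    using filterlim_compose[OF tendsto_radial_density[OF assms(1)] R_at_top] lim
    by (intro AE_I2 tendsto_mult)
  have "\<forall>\<^sub>F n in sequentially. \<forall>t. radial_density \<alpha> (R n) (R n - t) \<le> 4 * exponential_density \<alpha> t"
    by (rule eventually_compose_filterlim[OF
          eventually_radial_density_le_exponential_density[OF assms(1)] R_at_top])
  then show "\<forall>\<^sub>F n in sequentially. AE t in lborel. norm (radial_density \<alpha> (R n) (R n - t) * h n t)
      \<le> ?w t"
    using bound
  proof eventually_elim
    case (elim n)
    then have "\<bar>radial_density \<alpha> (R n) (R n - t) * h n t\<bar> \<le> ?w t" for t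
      using assms(1) by (intro abs_radial_density_mult_le) auto
    then show ?case
      by simp
  qed
qed auto

lemma integral_point_distribution_fst:
  fixes h :: "real \<Rightarrow> real"
  assumes "\<alpha> > 0" "R > 0" and [measurable]: "h \<in> borel_measurable borel"
  shows "(\<integral>x. h (fst x) \<partial>point_distribution \<alpha> R)
      = (\<integral>t. radial_density \<alpha> R (R - t) * h (R - t) \<partial>lborel)"
proof -
  let ?r = "density lborel (\<lambda>r. ennreal (radial_density \<alpha> R r))"
  interpret r: prob_space ?r
    by (rule prob_space_radial[OF assms(1,2)])
  interpret \<theta>: prob_space "uniform_measure lborel {0<..2 * pi}"
    by (rule prob_space_uniform_measure) auto
  have "(\<integral>x. h (fst x) \<partial>point_distribution \<alpha> R)
      = integral\<^sup>L (distr (point_distribution \<alpha> R) ?r fst) h"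
    unfolding point_distribution_def by (subst integral_distr) auto
  also have "distr (point_distribution \<alpha> R) ?r fst = ?r"
    unfolding point_distribution_def by (rule \<theta>.distr_pair_fst)
  also have "integral\<^sup>L ?r h = (\<integral>r. radial_density \<alpha> R r * h r \<partial>lborel)"
    using assms by (subst integral_density) (auto simp: radial_density_nonneg)
  also have "\<dots> = (\<integral>t. radial_density \<alpha> R (R - t) * h (R - t) \<partial>lborel)"
    by (subst lborel_integral_real_affine[where c = "- 1" and t = R]) auto
  finally show ?thesis .
qed

subsection \<open>Connection probabilities averaged over one endpoint\<close>

lemma connection_prob_cos_cong:
  assumes "cos (a - b) = cos (c - d)"
  shows "connection_prob \<zeta> \<beta> R (r, a) (s, b) = connection_prob \<zeta> \<beta> R (r, c) (s, d)"
  using assms by (simp add: connection_prob_def hyp_dist_def cos_relative_angle)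

lemma connection_prob_commute: "connection_prob \<zeta> \<beta> R u v = connection_prob \<zeta> \<beta> R v u"
  by (simp add: connection_prob_def hyp_dist_def relative_angle_def abs_minus_commute mult.commute)

lemma connection_prob_nonneg: "0 \<le> connection_prob \<zeta> \<beta> R u v"
  using connection_prob_bounds[of \<zeta> \<beta> R u v] by simp

lemma borel_measurable_connection_prob [measurable]:
  assumes [measurable]: "f \<in> M \<rightarrow>\<^sub>M borel \<Otimes>\<^sub>M borel" "g \<in> M \<rightarrow>\<^sub>M borel \<Otimes>\<^sub>M borel"
  shows "(\<lambda>x. connection_prob \<zeta> \<beta> R (f x) (g x)) \<in> borel_measurable M"
proof -
  have "(\<lambda>x. (f x, g x)) \<in> M \<rightarrow>\<^sub>M (borel \<Otimes>\<^sub>M borel) \<Otimes>\<^sub>M (borel \<Otimes>\<^sub>M borel)"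
    by measurable
  from measurable_compose[OF this connection_prob_measurable] show ?thesis
    by simp
qed

definition angular_connection_prob :: "real \<Rightarrow> real \<Rightarrow> real \<Rightarrow> real \<Rightarrow> real \<Rightarrow> real" where
  "angular_connection_prob \<zeta> \<beta> R r s =
     (\<integral>\<theta>. indicator {0<..pi} \<theta> * connection_prob \<zeta> \<beta> R (r, 0) (s, \<theta>) \<partial>lborel) / pi"

definition radial_connection_prob :: "real \<Rightarrow> real \<Rightarrow> real \<Rightarrow> real \<Rightarrow> real \<Rightarrow> real" where
  "radial_connection_prob \<zeta> \<alpha> \<beta> R r =
     (\<integral>s. radial_density \<alpha> R s * angular_connection_prob \<zeta> \<beta> R r s \<partial>lborel)"

lemma angular_connection_prob_measurable [measurable]:
  assumes [measurable]: "f \<in> borel_measurable M" "g \<in> borel_measurable M"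
  shows "(\<lambda>x. angular_connection_prob \<zeta> \<beta> R (f x) (g x)) \<in> borel_measurable M"
  unfolding angular_connection_prob_def by measurable

lemma radial_connection_prob_measurable [measurable]:
  "radial_connection_prob \<zeta> \<alpha> \<beta> R \<in> borel_measurable borel"
  unfolding radial_connection_prob_def[abs_def] by measurable

lemma angular_connection_prob_nonneg: "0 \<le> angular_connection_prob \<zeta> \<beta> R r s"
  unfolding angular_connection_prob_def
  by (intro divide_nonneg_pos Bochner_Integration.integral_nonneg)
    (auto simp: connection_prob_nonneg)

lemma integral_uniform_angle:
  "(\<integral>\<psi>. connection_prob \<zeta> \<beta> R (r, \<theta>) (s, \<psi>) \<partial>uniform_measure lborel {0<..2 * pi})
     = angular_connection_prob \<zeta> \<beta> R r s"
proof -
  define f where "f = (\<lambda>x. connection_prob \<zeta> \<beta> R (r, 0) (s, x))"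
  have [measurable]: "f \<in> borel_measurable borel"
    unfolding f_def by measurable
  have f_diff: "connection_prob \<zeta> \<beta> R (r, \<theta>) (s, \<psi>) = f (\<theta> - \<psi>)" for \<psi>
    unfolding f_def by (rule connection_prob_cos_cong) (simp add: cos_diff)
  have "uniform_measure lborel {0<..2 * pi}
      = density lborel (\<lambda>\<psi>. ennreal (indicator {0<..2 * pi} \<psi> / (2 * pi)))"
    unfolding uniform_measure_def using divide_ennreal[of 1 "2 * pi"]
    by (intro density_cong) (auto simp: indicator_def)
  then have "(\<integral>\<psi>. connection_prob \<zeta> \<beta> R (r, \<theta>) (s, \<psi>) \<partial>uniform_measure lborel {0<..2 * pi})
      = (\<integral>\<psi>. indicator {0<..2 * pi} \<psi> * f (\<theta> - \<psi>) \<partial>lborel) / (2 * pi)"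
    by (simp add: f_diff integral_density)
  also have "\<dots> = (\<integral>\<psi>. indicator {0<..pi} \<psi> * f \<psi> \<partial>lborel) / pi"
  proof -
    have "f (x + 2 * pi) = f x" "f (- x) = f x" for x
      unfolding f_def by (rule connection_prob_cos_cong; simp add: cos_diff)+
    then show ?thesis
      by (subst integral_even_periodic) (auto simp: f_def connection_prob_nonneg)
  qed
  finally show ?thesis
    by (simp add: angular_connection_prob_def f_def)
qed

lemma integral_connection_prob:
  assumes "\<alpha> > 0" "R > 0"
  shows "(\<integral>y. connection_prob \<zeta> \<beta> R x y \<partial>point_distribution \<alpha> R)
      = radial_connection_prob \<zeta> \<alpha> \<beta> R (fst x)"
proof -
  let ?r = "density lborel (\<lambda>r. ennreal (radial_density \<alpha> R r))"
  let ?\<theta> = "uniform_measure lborel {0<..2 * pi}"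
  interpret r: prob_space ?r
    by (rule prob_space_radial[OF assms])
  interpret \<theta>: prob_space ?\<theta>
    by (rule prob_space_uniform_measure) auto
  interpret pair_prob_space ?r ?\<theta> ..
  obtain r \<theta> where x: "x = (r, \<theta>)"
    by (cases x)
  have "integrable (?r \<Otimes>\<^sub>M ?\<theta>) (\<lambda>y. connection_prob \<zeta> \<beta> R (r, \<theta>) (fst y, snd y))"
    by (rule P.integrable_unit_interval[OF _ connection_prob_bounds]) measurable
  then have "(\<integral>y. connection_prob \<zeta> \<beta> R (r, \<theta>) (fst y, snd y) \<partial>point_distribution \<alpha> R)
      = (\<integral>s. (\<integral>\<psi>. connection_prob \<zeta> \<beta> R (r, \<theta>) (s, \<psi>) \<partial>?\<theta>) \<partial>?r)"
    unfolding point_distribution_def by (subst integral_fst'[symmetric]) auto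
  also have "\<dots> = radial_connection_prob \<zeta> \<alpha> \<beta> R r"
    unfolding integral_uniform_angle radial_connection_prob_def
    using assms by (subst integral_density) (auto simp: radial_density_nonneg)
  finally show ?thesis
    by (simp add: x)
qed

lemma radial_connection_prob_bounds:
  assumes "\<alpha> > 0" "R > 0"
  shows "radial_connection_prob \<zeta> \<alpha> \<beta> R r \<in> {0..1}"
proof -
  interpret prob_space "point_distribution \<alpha> R"
    by (rule prob_space_point_distribution[OF assms])
  show ?thesis
    using expectation_in_unit_interval[of "connection_prob \<zeta> \<beta> R (r, 0)", OF connection_prob_bounds]
    by (simp only: integral_connection_prob[OF assms] fst_conv)
qed

definition mean_avoidance :: "real \<Rightarrow> real \<Rightarrow> real \<Rightarrow> real \<Rightarrow> real \<Rightarrow> nat \<Rightarrow> real" where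
  "mean_avoidance \<zeta> \<alpha> \<beta> R \<sigma> n =
     (\<integral>x. (1 - \<sigma> * radial_connection_prob \<zeta> \<alpha> \<beta> R (fst x)) ^ n \<partial>point_distribution \<alpha> R)"

definition mean_square_connection_prob :: "real \<Rightarrow> real \<Rightarrow> real \<Rightarrow> real \<Rightarrow> real" where
  "mean_square_connection_prob \<zeta> \<alpha> \<beta> R =
     (\<integral>x. (radial_connection_prob \<zeta> \<alpha> \<beta> R (fst x))\<^sup>2 \<partial>point_distribution \<alpha> R)"

lemma connection_kernel_point_distribution:
  assumes "\<alpha> > 0" "R > 0"
  shows "connection_kernel (point_distribution \<alpha> R) (connection_prob \<zeta> \<beta> R)"
proof -
  interpret prob_space "point_distribution \<alpha> R"
    by (rule prob_space_point_distribution[OF assms])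
  show ?thesis
  proof
    show "(\<lambda>(x, y). connection_prob \<zeta> \<beta> R x y)
        \<in> borel_measurable (point_distribution \<alpha> R \<Otimes>\<^sub>M point_distribution \<alpha> R)"
      using connection_prob_measurable
      by (subst measurable_cong_sets[OF sets_pair_measure_cong[OF
              sets_point_distribution sets_point_distribution] refl])
  qed (rule connection_prob_bounds connection_prob_commute)+
qed

lemma mean_kernel_point_distribution:
  assumes "\<alpha> > 0" "R > 0"
  shows "connection_kernel.mean_kernel (point_distribution \<alpha> R) (connection_prob \<zeta> \<beta> R) x
    = radial_connection_prob \<zeta> \<alpha> \<beta> R (fst x)"
  unfolding connection_kernel.mean_kernel_def[OF connection_kernel_point_distribution[OF assms]]
  by (rule integral_connection_prob[OF assms])

subsection \<open>Expected degrees near the boundary\<close>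

locale hyperbolic_parameters =
  fixes \<zeta> \<alpha> \<beta> :: real
  assumes \<zeta>_pos: "\<zeta> > 0" and \<alpha>_pos: "\<alpha> > 0" and \<beta>_gt_1: "\<beta> > 1" and \<zeta>_less: "\<zeta> < 2 * \<alpha>"
begin

abbreviation (input) "R \<equiv> disc_radius \<zeta>"

abbreviation (input) "points N \<equiv> point_distribution \<alpha> (R N)"

abbreviation (input) "conn N \<equiv> radial_connection_prob \<zeta> \<alpha> \<beta> (R N)"

text \<open>Positions are described by the distances \<open>t\<close> and \<open>s\<close> from the boundary, and relative angles
  are measured in units of \<open>1 / N\<close>.\<close>

definition rescaled_connection_prob :: "nat \<Rightarrow> real \<Rightarrow> real \<Rightarrow> real \<Rightarrow> real" where
  "rescaled_connection_prob N t s \<phi> =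
     indicator {0<..real N * pi} \<phi> * connection_prob \<zeta> \<beta> (R N) (R N - t, 0) (R N - s, \<phi> / real N)"

definition connection_profile :: "real \<Rightarrow> real \<Rightarrow> real \<Rightarrow> real \<Rightarrow> real" where
  "connection_profile c t s \<phi> = indicator {0<..} \<phi> / (1 + (exp (- \<zeta> * (t + s) / 2) / c * \<phi>) powr \<beta>)"

definition pair_intensity :: "nat \<Rightarrow> real \<Rightarrow> real \<Rightarrow> real" where
  "pair_intensity N t s = real N * angular_connection_prob \<zeta> \<beta> (R N) (R N - t) (R N - s)"

definition degree_intensity :: "nat \<Rightarrow> real \<Rightarrow> real" where
  "degree_intensity N t = real N * conn N (R N - t)"

definition limit_intensity :: "real \<Rightarrow> real" where
  "limit_intensity t = mixing_constant \<zeta> \<alpha> \<beta> * exp (\<zeta> / 2 * t)"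

definition degree_intensity_bound :: real where
  "degree_intensity_bound = 4 * (2 * pi / (\<beta> * sin (pi / \<beta>))) * (\<alpha> / (\<alpha> - \<zeta> / 2))"

lemma eventually_le_disc_radius: "\<forall>\<^sub>F N in sequentially. t \<le> R N"
  using filterlim_disc_radius[OF \<zeta>_pos] by (simp add: filterlim_at_top)

lemma eventually_disc_radius_pos: "\<forall>\<^sub>F N in sequentially. R N > 0"
  using filterlim_disc_radius[OF \<zeta>_pos] by (simp add: filterlim_at_top_dense)

lemma sin_pi_div_\<beta>_pos: "sin (pi / \<beta>) > 0"
  using \<beta>_gt_1 by (intro sin_gt_zero) (auto simp: field_simps)

lemma rescaled_connection_prob_measurable [measurable]:
  "rescaled_connection_prob N t s \<in> borel_measurable borel"
  unfolding rescaled_connection_prob_def[abs_def] by measurable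

lemma rescaled_connection_prob_nonneg: "0 \<le> rescaled_connection_prob N t s \<phi>"
  by (simp add: rescaled_connection_prob_def connection_prob_nonneg)

lemma connection_profile_measurable [measurable]:
  "connection_profile c t s \<in> borel_measurable borel"
  unfolding connection_profile_def[abs_def] by measurable

lemma connection_profile_nonneg: "0 \<le> connection_profile c t s \<phi>"
  by (simp add: connection_profile_def add_nonneg_nonneg)

lemma rescaled_connection_prob_le:
  assumes "N > 0" "t \<le> R N" "s \<le> R N"
  shows "rescaled_connection_prob N t s \<phi> \<le> connection_profile (2 * pi) t s \<phi>"
proof (cases "\<phi> \<in> {0<..real N * pi}")
  case True
  have "exp (\<zeta> * (R N - t + (R N - s) - R N) / 2) = exp (\<zeta> * R N / 2) * exp (- \<zeta> * (t + s) / 2)"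
    by (simp flip: exp_add) (simp add: field_simps)
  also have "\<dots> = real N * exp (- \<zeta> * (t + s) / 2)"
    using \<zeta>_pos assms by (simp add: exp_disc_radius)
  finally have scale: "exp (\<zeta> * (R N - t + (R N - s) - R N) / 2)
      = real N * exp (- \<zeta> * (t + s) / 2)" .
  have angle: "0 \<le> \<phi> / real N" "\<phi> / real N \<le> pi"
    using True assms by (auto simp: field_simps)
  then have "\<bar>0 - \<phi> / real N\<bar> \<le> 2 * pi"
    by linarith
  then have "connection_prob \<zeta> \<beta> (R N) (R N - t, 0) (R N - s, \<phi> / real N)
      \<le> 1 / (1 + (real N * exp (- \<zeta> * (t + s) / 2) / (2 * pi) * (\<phi> / real N)) powr \<beta>)"
    using connection_prob_le[of \<zeta> \<beta> "(R N - t, 0)" "(R N - s, \<phi> / real N)" "R N"]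
      \<zeta>_pos \<beta>_gt_1 assms(2,3)
    by (simp only: scale relative_angle_0_left[OF angle] fst_conv snd_conv)
  then show ?thesis
    using True assms by (simp add: rescaled_connection_prob_def connection_profile_def)
next
  case False
  then show ?thesis
    by (simp add: rescaled_connection_prob_def connection_profile_nonneg)
qed

lemma tendsto_rescaled_connection_prob:
  "(\<lambda>N. rescaled_connection_prob N t s \<phi>) \<longlonglongrightarrow> connection_profile 2 t s \<phi>"
proof (cases "\<phi> > 0")
  case True
  have "\<forall>\<^sub>F N in sequentially. \<phi> \<le> real N * pi"
    by real_asymp
  then have "\<forall>\<^sub>F N in sequentially. connection_prob \<zeta> \<beta> (R N) (R N - t, 0) (R N - s, \<phi> / real N)
      = rescaled_connection_prob N t s \<phi>"
    by eventually_elim (use True in \<open>simp add: rescaled_connection_prob_def\<close>)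
  moreover have "(\<lambda>N. connection_prob \<zeta> \<beta> (R N) (R N - t, 0) (R N - s, \<phi> / real N))
      \<longlonglongrightarrow> connection_profile 2 t s \<phi>"
    using tendsto_connection_prob_near_boundary[of \<zeta> \<beta> \<phi> t s] True \<zeta>_pos \<beta>_gt_1
    by (simp add: connection_profile_def)
  ultimately show ?thesis
    by (simp add: Lim_transform_eventually)
qed (simp add: rescaled_connection_prob_def connection_profile_def)

lemma pair_intensity_eq:
  assumes "N > 0"
  shows "pair_intensity N t s = (\<integral>\<phi>. rescaled_connection_prob N t s \<phi> \<partial>lborel) / pi"
proof -
  have "indicator {0<..pi} (x / real N) = (indicator {0<..real N * pi} x :: real)" for x
    using assms by (auto simp: indicator_def field_simps)
  then show ?thesis
    unfolding pair_intensity_def angular_connection_prob_def rescaled_connection_prob_def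
    using assms
    by (subst lborel_integral_real_affine[where c = "1 / real N" and t = 0]) auto
qed

lemma has_bochner_integral_connection_profile:
  assumes "c > 0"
  shows "has_bochner_integral lborel (connection_profile c t s)
    (c * pi / (\<beta> * sin (pi / \<beta>)) * exp (\<zeta> / 2 * (t + s)))"
proof -
  have "exp (- \<zeta> * (t + s) / 2) = 1 / exp (\<zeta> / 2 * (t + s))"
    by (simp add: exp_minus inverse_eq_divide)
  then have "pi / (\<beta> * sin (pi / \<beta>)) / (exp (- \<zeta> * (t + s) / 2) / c)
      = c * pi / (\<beta> * sin (pi / \<beta>)) * exp (\<zeta> / 2 * (t + s))"
    by simp
  then show ?thesis
    using has_bochner_integral_inverse_one_plus_powr[of \<beta> "exp (- \<zeta> * (t + s) / 2) / c"]
      \<beta>_gt_1 assms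
    by (simp only: connection_profile_def[abs_def] exp_gt_zero divide_pos_pos)
qed

lemma pair_intensity_le:
  assumes "N > 0" "t \<le> R N" "s \<le> R N"
  shows "pair_intensity N t s \<le> 2 * pi / (\<beta> * sin (pi / \<beta>)) * exp (\<zeta> / 2 * (t + s))"
proof -
  have profile: "has_bochner_integral lborel (connection_profile (2 * pi) t s)
      (2 * pi * pi / (\<beta> * sin (pi / \<beta>)) * exp (\<zeta> / 2 * (t + s)))"
    by (rule has_bochner_integral_connection_profile) simp
  have "(\<integral>\<phi>. rescaled_connection_prob N t s \<phi> \<partial>lborel)
      \<le> integral\<^sup>L lborel (connection_profile (2 * pi) t s)"
    using integrable.intros[OF profile] rescaled_connection_prob_le[OF assms]
      connection_profile_nonneg
    by (rule integral_mono')
  then show ?thesis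
    using has_bochner_integral_integral_eq[OF profile] assms(1)
    by (simp add: pair_intensity_eq field_simps)
qed

lemma tendsto_pair_intensity:
  "(\<lambda>N. pair_intensity N t s) \<longlonglongrightarrow> 2 / (\<beta> * sin (pi / \<beta>)) * exp (\<zeta> / 2 * (t + s))"
proof (rule Lim_transform_eventually)
  have "(\<lambda>N. \<integral>\<phi>. rescaled_connection_prob N t s \<phi> \<partial>lborel)
      \<longlonglongrightarrow> integral\<^sup>L lborel (connection_profile 2 t s)"
  proof (rule integral_dominated_convergence_eventually)
    show "integrable lborel (connection_profile (2 * pi) t s)"
      by (rule integrable.intros[OF has_bochner_integral_connection_profile]) simp
    show "\<forall>\<^sub>F N in sequentially. AE \<phi> in lborel. norm (rescaled_connection_prob N t s \<phi>)
        \<le> connection_profile (2 * pi) t s \<phi>"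
      using eventually_le_disc_radius[of t] eventually_le_disc_radius[of s]
        eventually_gt_at_top[of 0]
      by eventually_elim
        (simp only: real_norm_def abs_of_nonneg[OF rescaled_connection_prob_nonneg]
          rescaled_connection_prob_le AE_I2)
  qed (use tendsto_rescaled_connection_prob in auto)
  also have "integral\<^sup>L lborel (connection_profile 2 t s)
      = 2 * pi / (\<beta> * sin (pi / \<beta>)) * exp (\<zeta> / 2 * (t + s))"
    by (rule has_bochner_integral_integral_eq[OF has_bochner_integral_connection_profile]) simp
  finally have "(\<lambda>N. (\<integral>\<phi>. rescaled_connection_prob N t s \<phi> \<partial>lborel) / pi)
      \<longlonglongrightarrow> 2 * pi / (\<beta> * sin (pi / \<beta>)) * exp (\<zeta> / 2 * (t + s)) / pi"
    by (intro tendsto_divide tendsto_const) auto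
  then show "(\<lambda>N. (\<integral>\<phi>. rescaled_connection_prob N t s \<phi> \<partial>lborel) / pi)
      \<longlonglongrightarrow> 2 / (\<beta> * sin (pi / \<beta>)) * exp (\<zeta> / 2 * (t + s))"
    by simp
  show "\<forall>\<^sub>F N in sequentially. (\<integral>\<phi>. rescaled_connection_prob N t s \<phi> \<partial>lborel) / pi
      = pair_intensity N t s"
    using eventually_gt_at_top[of 0] by eventually_elim (simp add: pair_intensity_eq)
qed

lemma pair_intensity_measurable [measurable]: "pair_intensity N t \<in> borel_measurable borel"
  unfolding pair_intensity_def[abs_def] by measurable

lemma pair_intensity_nonneg: "0 \<le> pair_intensity N t s"
  by (simp add: pair_intensity_def angular_connection_prob_nonneg)

lemma exp_half_add: "exp (\<zeta> / 2 * (t + s)) = exp (\<zeta> / 2 * t) * exp (\<zeta> / 2 * s)"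
  by (simp only: distrib_left exp_add)

lemma degree_intensity_eq:
  "degree_intensity N t = (\<integral>s. radial_density \<alpha> (R N) (R N - s) * pair_intensity N t s \<partial>lborel)"
proof -
  have "conn N (R N - t)
      = (\<integral>s. radial_density \<alpha> (R N) (R N - s)
          * angular_connection_prob \<zeta> \<beta> (R N) (R N - t) (R N - s) \<partial>lborel)"
    unfolding radial_connection_prob_def
    by (subst lborel_integral_real_affine[where c = "- 1" and t = "R N"]) auto
  then show ?thesis
    by (simp add: degree_intensity_def pair_intensity_def mult.left_commute)
qed

lemma degree_intensity_le:
  assumes "N > 0" "t \<le> R N"
    and density_le: "\<And>s. radial_density \<alpha> (R N) (R N - s) \<le> 4 * exponential_density \<alpha> s"
  shows "degree_intensity N t \<le> degree_intensity_bound * exp (\<zeta> / 2 * t)"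
proof -
  define D where "D = 2 * pi / (\<beta> * sin (pi / \<beta>))"
  have "D \<ge> 0"
    unfolding D_def using sin_pi_div_\<beta>_pos \<beta>_gt_1 by (intro divide_nonneg_pos) auto
  have tilted: "has_bochner_integral lborel (\<lambda>s. exponential_density \<alpha> s * exp (\<zeta> / 2 * s))
      (\<alpha> / (\<alpha> - \<zeta> / 2))"
    using \<zeta>_less by (intro has_bochner_integral_exponential_density_mult_exp) auto
  let ?w = "\<lambda>s. 4 * D * exp (\<zeta> / 2 * t) * (exponential_density \<alpha> s * exp (\<zeta> / 2 * s))"
  have "degree_intensity N t \<le> integral\<^sup>L lborel ?w"
    unfolding degree_intensity_eq
  proof (rule integral_mono')
    show "integrable lborel ?w"
      using integrable.intros[OF tilted] by (rule integrable_mult_right)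
    show "0 \<le> ?w s" for s
      using \<open>D \<ge> 0\<close> \<alpha>_pos by (simp add: exponential_density_nonneg)
    show "radial_density \<alpha> (R N) (R N - s) * pair_intensity N t s \<le> ?w s" for s
    proof -
      have "\<bar>pair_intensity N t s\<bar> \<le> D * exp (\<zeta> / 2 * t) * exp (\<zeta> / 2 * s)" if "s \<in> {0..R N}"
        using pair_intensity_le[of N t s] assms(1,2) that unfolding exp_half_add D_def
        by (auto simp: pair_intensity_nonneg mult.assoc)
      from abs_radial_density_mult_le[OF \<alpha>_pos density_le this] show ?thesis
        using \<open>D \<ge> 0\<close> by (simp add: abs_le_iff mult_ac)
    qed
  qed
  also have "\<dots> = 4 * D * exp (\<zeta> / 2 * t) * (\<alpha> / (\<alpha> - \<zeta> / 2))"
    using has_bochner_integral_integral_eq[OF tilted] by simp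
  finally show ?thesis
    by (simp add: degree_intensity_bound_def D_def mult_ac)
qed

lemma tendsto_degree_intensity: "(\<lambda>N. degree_intensity N t) \<longlonglongrightarrow> limit_intensity t"
proof -
  define c where "c = 2 / (\<beta> * sin (pi / \<beta>))"
  have "(\<lambda>N. degree_intensity N t)
      \<longlonglongrightarrow> (\<integral>s. exponential_density \<alpha> s * (c * exp (\<zeta> / 2 * (t + s))) \<partial>lborel)"
    unfolding degree_intensity_eq
  proof (rule tendsto_integral_radial_density[where \<gamma> = "\<zeta> / 2"])
    show "(\<lambda>N. pair_intensity N t s) \<longlonglongrightarrow> c * exp (\<zeta> / 2 * (t + s))" for s
      unfolding c_def by (rule tendsto_pair_intensity)
    show "\<forall>\<^sub>F N in sequentially. \<forall>s\<in>{0..R N}.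
        \<bar>pair_intensity N t s\<bar> \<le> 2 * pi / (\<beta> * sin (pi / \<beta>)) * exp (\<zeta> / 2 * t) * exp (\<zeta> / 2 * s)"
      using eventually_le_disc_radius[of t] eventually_gt_at_top[of 0]
    proof eventually_elim
      case (elim N)
      then show ?case
        using pair_intensity_le[of N t] unfolding exp_half_add
        by (auto simp: pair_intensity_nonneg mult.assoc)
    qed
  qed (use \<alpha>_pos \<zeta>_pos \<zeta>_less in \<open>auto intro: filterlim_disc_radius\<close>)
  also have "(\<integral>s. exponential_density \<alpha> s * (c * exp (\<zeta> / 2 * (t + s))) \<partial>lborel)
      = c * exp (\<zeta> / 2 * t) * (\<integral>s. exponential_density \<alpha> s * exp (\<zeta> / 2 * s) \<partial>lborel)"
    unfolding exp_half_add by (simp add: mult_ac flip: integral_mult_right_zero)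
  also have "(\<integral>s. exponential_density \<alpha> s * exp (\<zeta> / 2 * s) \<partial>lborel) = \<alpha> / (\<alpha> - \<zeta> / 2)"
    using \<zeta>_less
    by (intro has_bochner_integral_integral_eq has_bochner_integral_exponential_density_mult_exp)
      auto
  also have "c * exp (\<zeta> / 2 * t) * (\<alpha> / (\<alpha> - \<zeta> / 2)) = limit_intensity t"
    using \<zeta>_less by (simp add: c_def limit_intensity_def mixing_constant_def field_simps)
  finally show ?thesis .
qed

lemma tendsto_integral_point_distribution:
  fixes h :: "nat \<Rightarrow> real \<Rightarrow> real" and h_lim :: "real \<Rightarrow> real"
  assumes [measurable]: "\<And>N. h N \<in> borel_measurable borel" "h_lim \<in> borel_measurable borel"
    and "\<And>t. (\<lambda>N. h N (R N - t)) \<longlonglongrightarrow> h_lim t"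
    and "\<forall>\<^sub>F N in sequentially. \<forall>t\<in>{0..R N}. \<bar>h N (R N - t)\<bar> \<le> C * exp (\<zeta> / 2 * t)"
  shows "(\<lambda>N. \<integral>x. h N (fst x) \<partial>points N) \<longlonglongrightarrow> (\<integral>t. h_lim t \<partial>exponential_measure \<alpha>)"
proof (rule Lim_transform_eventually)
  have "(\<lambda>N. \<integral>t. radial_density \<alpha> (R N) (R N - t) * h N (R N - t) \<partial>lborel)
      \<longlonglongrightarrow> (\<integral>t. exponential_density \<alpha> t * h_lim t \<partial>lborel)"
    using assms \<alpha>_pos \<zeta>_less
    by (intro tendsto_integral_radial_density[where \<gamma> = "\<zeta> / 2"] filterlim_disc_radius[OF \<zeta>_pos])
      auto
  also have "(\<integral>t. exponential_density \<alpha> t * h_lim t \<partial>lborel) = (\<integral>t. h_lim t \<partial>exponential_measure \<alpha>)"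
    using \<alpha>_pos by (subst integral_density) (auto simp: exponential_density_nonneg)
  finally show "(\<lambda>N. \<integral>t. radial_density \<alpha> (R N) (R N - t) * h N (R N - t) \<partial>lborel)
      \<longlonglongrightarrow> (\<integral>t. h_lim t \<partial>exponential_measure \<alpha>)" .
  show "\<forall>\<^sub>F N in sequentially. (\<integral>t. radial_density \<alpha> (R N) (R N - t) * h N (R N - t) \<partial>lborel)
      = (\<integral>x. h N (fst x) \<partial>points N)"
    using eventually_disc_radius_pos
    by eventually_elim (use \<alpha>_pos in \<open>simp add: integral_point_distribution_fst\<close>)
qed

lemma eventually_radial_connection_prob_bounds:
  "\<forall>\<^sub>F N in sequentially. \<forall>r. conn N r \<in> {0..1}"
  using eventually_disc_radius_pos
  by eventually_elim (use radial_connection_prob_bounds \<alpha>_pos in blast)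

lemma tendsto_mean_avoidance:
  assumes "\<sigma> \<in> {0..1}"
  shows "(\<lambda>N. mean_avoidance \<zeta> \<alpha> \<beta> (R N) \<sigma> (N - j))
    \<longlonglongrightarrow> (\<integral>t. exp (- (\<sigma> * limit_intensity t)) \<partial>exponential_measure \<alpha>)"
  unfolding mean_avoidance_def
proof (rule tendsto_integral_point_distribution[where C = 1])
  let ?p = "\<lambda>N t. conn N (R N - t)"
  show "(\<lambda>N. (1 - \<sigma> * ?p N t) ^ (N - j)) \<longlonglongrightarrow> exp (- (\<sigma> * limit_intensity t))" for t
  proof (rule tendsto_power_one_minus; rule Lim_transform_eventually)
    have "(\<lambda>N. real (N - j) / real N) \<longlonglongrightarrow> 1"
      by real_asymp
    from tendsto_mult[OF this tendsto_mult[OF tendsto_const tendsto_degree_intensity]]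
    show "(\<lambda>N. real (N - j) / real N * (\<sigma> * degree_intensity N t)) \<longlonglongrightarrow> \<sigma> * limit_intensity t"
      by simp
    from tendsto_mult[OF lim_1_over_n tendsto_mult[OF tendsto_const tendsto_degree_intensity]]
    show "(\<lambda>N. 1 / real N * (\<sigma> * degree_intensity N t)) \<longlonglongrightarrow> 0"
      by simp
    show "\<forall>\<^sub>F N in sequentially. real (N - j) / real N * (\<sigma> * degree_intensity N t)
        = real (N - j) * (\<sigma> * ?p N t)"
      "\<forall>\<^sub>F N in sequentially. 1 / real N * (\<sigma> * degree_intensity N t) = \<sigma> * ?p N t"
      using eventually_gt_at_top[of 0] by (eventually_elim, simp add: degree_intensity_def)+
  qed
  show "\<forall>\<^sub>F N in sequentially. \<forall>t\<in>{0..R N}. \<bar>(1 - \<sigma> * ?p N t) ^ (N - j)\<bar> \<le> 1 * exp (\<zeta> / 2 * t)"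
    using eventually_radial_connection_prob_bounds
  proof eventually_elim
    case (elim N)
    show ?case
    proof
      fix t assume "t \<in> {0..R N}"
      have "0 \<le> \<sigma> * ?p N t" "\<sigma> * ?p N t \<le> 1"
        using elim assms by (auto intro: mult_le_one)
      then have "\<bar>1 - \<sigma> * ?p N t\<bar> ^ (N - j) \<le> 1"
        by (intro power_le_one) auto
      also have "\<dots> \<le> exp (\<zeta> / 2 * t)"
        using \<open>t \<in> _\<close> \<zeta>_pos by simp
      finally show "\<bar>(1 - \<sigma> * ?p N t) ^ (N - j)\<bar> \<le> 1 * exp (\<zeta> / 2 * t)"
        by (simp add: power_abs)
    qed
  qed
qed (auto simp: limit_intensity_def)
lemma eventually_degree_intensity_le:
  "\<forall>\<^sub>F N in sequentially. \<forall>t\<in>{0..R N}. degree_intensity N t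
      \<le> degree_intensity_bound * exp (\<zeta> / 2 * t)"
  using eventually_gt_at_top[of 0]
    eventually_compose_filterlim[OF eventually_radial_density_le_exponential_density[OF \<alpha>_pos]
      filterlim_disc_radius[OF \<zeta>_pos]]
  by eventually_elim (intro ballI degree_intensity_le; simp)


lemma tendsto_mult_mean_square_connection_prob:
  "(\<lambda>N. real N * mean_square_connection_prob \<zeta> \<alpha> \<beta> (R N)) \<longlonglongrightarrow> 0"
proof -
  have "(\<lambda>N. \<integral>x. real N * (conn N (fst x))\<^sup>2 \<partial>points N) \<longlonglongrightarrow> (\<integral>t. 0 \<partial>exponential_measure \<alpha>)"
  proof (rule tendsto_integral_point_distribution)
    show "(\<lambda>N. real N * (conn N (R N - t))\<^sup>2) \<longlonglongrightarrow> 0" for t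
    proof (rule Lim_transform_eventually)
      from tendsto_mult[OF tendsto_power[OF tendsto_degree_intensity] lim_1_over_n]
      show "(\<lambda>N. (degree_intensity N t)\<^sup>2 * (1 / real N)) \<longlonglongrightarrow> 0"
        by simp
      show "\<forall>\<^sub>F N in sequentially. (degree_intensity N t)\<^sup>2 * (1 / real N)
          = real N * (conn N (R N - t))\<^sup>2"
        using eventually_gt_at_top[of 0]
        by eventually_elim (simp add: degree_intensity_def power2_eq_square)
    qed
    show "\<forall>\<^sub>F N in sequentially. \<forall>t\<in>{0..R N}. \<bar>real N * (conn N (R N - t))\<^sup>2\<bar>
        \<le> degree_intensity_bound * exp (\<zeta> / 2 * t)"
      using eventually_radial_connection_prob_bounds eventually_degree_intensity_le
    proof eventually_elim
      case (elim N)
      have "\<bar>real N * (conn N (R N - t))\<^sup>2\<bar> \<le> degree_intensity N t" for t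
        using elim(1)
        by (auto simp: degree_intensity_def power2_eq_square intro!: mult_left_mono mult_left_le)
      then show ?case
        using elim(2) by (blast intro: order_trans)
    qed
  qed auto
  then show ?thesis
    by (simp add: mean_square_connection_prob_def)
qed

end

subsection \<open>Conditional independence of the edges\<close>

lemma expectation_prod_Pi_pmf_bernoulli:
  fixes s :: real
  assumes "finite A" "B \<subseteq> A" "0 \<le> s" and p_bounds: "\<And>e. p e \<in> {0..1}"
  shows "measure_pmf.expectation (Pi_pmf A dflt (\<lambda>e. bernoulli_pmf (p e)))
      (\<lambda>G. \<Prod>e\<in>B. if G e then s else 1)
    = (\<Prod>e\<in>B. 1 - (1 - s) * p e)"
proof -
  let ?f = "\<lambda>e b. if e \<in> B \<and> b then s else 1"
  have "(\<Prod>e\<in>B. if G e then s else 1) = (\<Prod>e\<in>A. ?f e (G e))" for G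
    using assms by (intro prod.mono_neutral_cong_left) auto
  then have "measure_pmf.expectation (Pi_pmf A dflt (\<lambda>e. bernoulli_pmf (p e)))
      (\<lambda>G. \<Prod>e\<in>B. if G e then s else 1)
      = (\<Prod>e\<in>A. measure_pmf.expectation (bernoulli_pmf (p e)) (?f e))"
    using expectation_prod_Pi_pmf[of A "\<lambda>e. bernoulli_pmf (p e)" ?f dflt] assms
    by (simp add: integrable_measure_pmf_finite)
  also have "\<dots> = (\<Prod>e\<in>B. 1 - (1 - s) * p e)"
    using assms p_bounds by (intro prod.mono_neutral_cong_right) (auto simp: algebra_simps)
  finally show ?thesis .
qed

definition edge :: "nat \<times> nat \<Rightarrow> nat \<times> nat" where
  "edge = (\<lambda>(u, v). (min u v, max u v))"

lemma adjacent_iff_edge: "u \<noteq> v \<Longrightarrow> adjacent G u v \<longleftrightarrow> G (edge (u, v))"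
  by (cases u v rule: linorder_cases) (auto simp: adjacent_def edge_def min_def max_def)

lemma expectation_prod_adjacent:
  assumes "inj_on edge W" "\<And>u v. (u, v) \<in> W \<Longrightarrow> u < N \<and> v < N \<and> u \<noteq> v" "0 \<le> s"
  shows "measure_pmf.expectation (edges_given_positions \<zeta> \<beta> N x)
      (\<lambda>G. \<Prod>(u, v)\<in>W. if adjacent G u v then s else 1)
    = (\<Prod>(u, v)\<in>W. 1 - (1 - s) * connection_prob \<zeta> \<beta> (disc_radius \<zeta> N) (x u) (x v))"
proof -
  define P where "P = {(u, v). u < v \<and> v < N}"
  define c where "c = (\<lambda>(u, v). connection_prob \<zeta> \<beta> (disc_radius \<zeta> N) (x u) (x v))"
  have "finite P"
    by (rule finite_subset[of _ "{..<N} \<times> {..<N}"]) (auto simp: P_def)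
  have edge_subset: "edge ` W \<subseteq> P"
    using assms(2) by (fastforce simp: edge_def P_def min_def max_def)
  have c_bounds: "c e \<in> {0..1}" for e
    using connection_prob_bounds by (simp only: c_def split: prod.split) blast
  have "(\<Prod>(u, v)\<in>W. if adjacent G u v then s else 1) = (\<Prod>e\<in>edge ` W. if G e then s else 1)" for G
    unfolding prod.reindex[OF assms(1)] using assms(2)
    by (intro prod.cong) (auto simp: adjacent_iff_edge)
  then have "measure_pmf.expectation (edges_given_positions \<zeta> \<beta> N x)
      (\<lambda>G. \<Prod>(u, v)\<in>W. if adjacent G u v then s else 1)
      = measure_pmf.expectation (Pi_pmf P False (\<lambda>e. bernoulli_pmf (c e)))
          (\<lambda>G. \<Prod>e\<in>edge ` W. if G e then s else 1)"
    by (simp add: edges_given_positions_def P_def c_def case_prod_unfold)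
  also have "\<dots> = (\<Prod>e\<in>edge ` W. 1 - (1 - s) * c e)"
    using \<open>finite P\<close> edge_subset assms(3) c_bounds by (rule expectation_prod_Pi_pmf_bernoulli)
  also have "\<dots> = (\<Prod>(u, v)\<in>W. 1 - (1 - s) * connection_prob \<zeta> \<beta> (disc_radius \<zeta> N) (x u) (x v))"
    unfolding prod.reindex[OF assms(1)]
    by (intro prod.cong) (auto simp: c_def edge_def min_def max_def connection_prob_commute)
  finally show ?thesis .
qed

lemma expectation_prod_adjacent_vertices:
  assumes "U \<subseteq> {..<N}" "0 \<le> s"
  shows "measure_pmf.expectation (edges_given_positions \<zeta> \<beta> N x)
      (\<lambda>G. \<Prod>w\<in>{..<N} - U. \<Prod>z\<in>U. if adjacent G z w then s else 1)
    = (\<Prod>w\<in>{..<N} - U. \<Prod>z\<in>U. 1 - (1 - s) * connection_prob \<zeta> \<beta> (disc_radius \<zeta> N) (x z) (x w))"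
proof -
  have "inj_on edge (U \<times> ({..<N} - U))"
    by (auto simp: inj_on_def edge_def min_def max_def split: if_splits)
  from expectation_prod_adjacent[OF this, of N s \<zeta> \<beta> x] show ?thesis
    using assms
    by (subst (1 2) prod.swap) (auto simp: prod.cartesian_product)
qed

lemma measurable_random_graph: "f \<in> borel_measurable (random_graph \<zeta> \<alpha> \<beta> N)"
  by (simp add: measurable_def sets_random_graph)

lemma
  fixes f :: "edges \<Rightarrow> real"
  assumes "\<zeta> > 0" "\<alpha> > 0" "N \<ge> 2" and f: "\<And>G. f G \<in> {0..1}"
  shows integrable_random_graph: "integrable (random_graph \<zeta> \<alpha> \<beta> N) f"
    and integral_random_graph: "(\<integral>G. f G \<partial>random_graph \<zeta> \<alpha> \<beta> N)
      = (\<integral>x. measure_pmf.expectation (edges_given_positions \<zeta> \<beta> N x) f \<partial>positions \<zeta> \<alpha> N)"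
proof -
  interpret prob_space "positions \<zeta> \<alpha> N"
    using assms by (intro prob_space_positions)
  note edges_measurable = measurable_prob_algebraD[OF edges_given_positions_measurable]
  have bound: "\<bar>f G\<bar> \<le> 1" for G
    using f[of G] by simp
  have mass: "AE x in positions \<zeta> \<alpha> N. emeasure (edges_given_positions \<zeta> \<beta> N x)
      (space (edges_given_positions \<zeta> \<beta> N x)) \<le> ennreal 1"
    by (simp add: measure_pmf.emeasure_space_1)
  show "integrable (random_graph \<zeta> \<alpha> \<beta> N) f"
    unfolding random_graph_def
    by (rule integrable_bind[OF _ bound edges_measurable finite_measure_axioms mass]) auto
  show "(\<integral>G. f G \<partial>random_graph \<zeta> \<alpha> \<beta> N)
      = (\<integral>x. measure_pmf.expectation (edges_given_positions \<zeta> \<beta> N x) f \<partial>positions \<zeta> \<alpha> N)"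
    unfolding random_graph_def
    by (rule integral_bind[OF _ bound edges_measurable finite_measure_axioms mass]) auto
qed

lemma power_vertex_degree_eq:
  fixes s :: real
  shows "s ^ vertex_degree N G v = (\<Prod>w\<in>{..<N} - {v}. if adjacent G v w then s else 1)"
proof -
  have "vertex_degree N G v = card {w \<in> {..<N} - {v}. adjacent G v w}"
    unfolding vertex_degree_def by (intro arg_cong[where f = card]) (auto simp: adjacent_def)
  moreover have "(\<Prod>w\<in>{..<N} - {v}. if adjacent G v w then s else 1)
      = (\<Prod>w\<in>{w \<in> {..<N} - {v}. adjacent G v w}. s)"
    by (intro prod.inter_filter[symmetric]) auto
  ultimately show ?thesis
    by simp
qed

text \<open>Dropping the factor of the pair \<open>u\<close>, \<open>v\<close> itself leaves a product over disjoint sets of edges.\<close>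

lemma power_vertex_degree_mult_le:
  fixes s :: real
  assumes "s \<in> {0..1}" "u \<noteq> v"
  shows "s ^ vertex_degree N G u * s ^ vertex_degree N G v
    \<le> (\<Prod>w\<in>{..<N} - {u, v}. \<Prod>z\<in>{u, v}. if adjacent G z w then s else 1)"
proof -
  have "s ^ vertex_degree N G z
      \<le> (\<Prod>w\<in>{..<N} - {u, v}. if adjacent G z w then s else 1)" if "z \<in> {u, v}" for z
    unfolding power_vertex_degree_eq using that assms by (intro prod_le_prod_subset) auto
  then have "s ^ vertex_degree N G u * s ^ vertex_degree N G v
      \<le> (\<Prod>w\<in>{..<N} - {u, v}. if adjacent G u w then s else 1)
        * (\<Prod>w\<in>{..<N} - {u, v}. if adjacent G v w then s else 1)"
    using assms by (intro mult_mono prod_nonneg) auto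
  then show ?thesis
    using assms by (simp add: prod.distrib)
qed

lemma integral_power_vertex_degree:
  assumes "\<zeta> > 0" "\<alpha> > 0" "N \<ge> 2" "v < N" "s \<in> {0..1}"
  shows "(\<integral>G. s ^ vertex_degree N G v \<partial>random_graph \<zeta> \<alpha> \<beta> N)
    = mean_avoidance \<zeta> \<alpha> \<beta> (disc_radius \<zeta> N) (1 - s) (N - 1)"
proof -
  have R_pos: "disc_radius \<zeta> N > 0"
    using assms by (simp add: disc_radius_def)
  interpret connection_kernel "point_distribution \<alpha> (disc_radius \<zeta> N)"
      "connection_prob \<zeta> \<beta> (disc_radius \<zeta> N)"
    by (rule connection_kernel_point_distribution[OF assms(2) R_pos])
  have "(\<integral>G. s ^ vertex_degree N G v \<partial>random_graph \<zeta> \<alpha> \<beta> N)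
      = (\<integral>x. measure_pmf.expectation (edges_given_positions \<zeta> \<beta> N x)
          (\<lambda>G. s ^ vertex_degree N G v) \<partial>positions \<zeta> \<alpha> N)"
    using assms by (intro integral_random_graph power_in_unit_interval)
  also have "\<dots>
      = (\<integral>x. (\<Prod>w\<in>{..<N} - {v}. 1 - (1 - s) * connection_prob \<zeta> \<beta> (disc_radius \<zeta> N) (x v) (x w))
          \<partial>positions \<zeta> \<alpha> N)"
    using expectation_prod_adjacent_vertices[of "{v}" N s \<zeta> \<beta>] assms
    by (simp add: power_vertex_degree_eq)
  also have "\<dots>
      = (\<integral>x. (1 - (1 - s) * mean_kernel x) ^ (N - 1) \<partial>point_distribution \<alpha> (disc_radius \<zeta> N))"
    unfolding positions_def using integral_prod_avoid_vertex[of "{..<N}" v "1 - s"] assms by simp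
  finally show ?thesis
    by (simp add: mean_kernel_point_distribution[OF assms(2) R_pos] mean_avoidance_def)
qed

lemma integral_power_vertex_degree_mult_le:
  assumes "\<zeta> > 0" "\<alpha> > 0" "N \<ge> 2" "u < N" "v < N" "u \<noteq> v" "s \<in> {0..1}"
  shows "(\<integral>G. s ^ vertex_degree N G u * s ^ vertex_degree N G v \<partial>random_graph \<zeta> \<alpha> \<beta> N)
    \<le> (mean_avoidance \<zeta> \<alpha> \<beta> (disc_radius \<zeta> N) (1 - s) (N - 2))\<^sup>2
      + real N * mean_square_connection_prob \<zeta> \<alpha> \<beta> (disc_radius \<zeta> N)"
proof -
  have R_pos: "disc_radius \<zeta> N > 0"
    using assms by (simp add: disc_radius_def)
  interpret connection_kernel "point_distribution \<alpha> (disc_radius \<zeta> N)"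
      "connection_prob \<zeta> \<beta> (disc_radius \<zeta> N)"
    by (rule connection_kernel_point_distribution[OF assms(2) R_pos])
  let ?g = "\<lambda>G. \<Prod>w\<in>{..<N} - {u, v}. \<Prod>z\<in>{u, v}. if adjacent G z w then s else 1"
  have g_bounds: "?g G \<in> {0..1}" for G
    using assms by (intro prod_in_unit_interval) auto
  have "(\<integral>G. s ^ vertex_degree N G u * s ^ vertex_degree N G v \<partial>random_graph \<zeta> \<alpha> \<beta> N)
      \<le> (\<integral>G. ?g G \<partial>random_graph \<zeta> \<alpha> \<beta> N)"
    using assms
    by (intro integral_mono integrable_random_graph unit_interval_intros
        power_vertex_degree_mult_le g_bounds) auto
  also have "\<dots> = (\<integral>x. measure_pmf.expectation (edges_given_positions \<zeta> \<beta> N x) ?g \<partial>positions \<zeta> \<alpha> N)"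
    using assms by (intro integral_random_graph g_bounds)
  also have "\<dots>
      = (\<integral>x. (\<Prod>w\<in>{..<N} - {u, v}. (1 - (1 - s) * connection_prob \<zeta> \<beta> (disc_radius \<zeta> N) (x u) (x w))
       * (1 - (1 - s) * connection_prob \<zeta> \<beta> (disc_radius \<zeta> N) (x v) (x w))) \<partial>positions \<zeta> \<alpha> N)"
    using expectation_prod_adjacent_vertices[of "{u, v}" N s \<zeta> \<beta>] assms by simp
  also have "\<dots>
      \<le> (\<integral>x. (1 - (1 - s) * mean_kernel x) ^ (N - 2) \<partial>point_distribution \<alpha> (disc_radius \<zeta> N))\<^sup>2
      + real N * (\<integral>x. (mean_kernel x)\<^sup>2 \<partial>point_distribution \<alpha> (disc_radius \<zeta> N))"
    unfolding positions_def using integral_prod_avoid_pair_le[of "{..<N}" u v "1 - s"] assms by simp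
  finally show ?thesis
    by (simp add: mean_kernel_point_distribution[OF assms(2) R_pos] mean_avoidance_def
        mean_square_connection_prob_def)
qed

subsection \<open>The degree distribution\<close>

definition degree_pmf :: "nat \<Rightarrow> edges \<Rightarrow> nat pmf" where
  "degree_pmf N G = map_pmf (vertex_degree N G) (pmf_of_set {..<N})"

lemma pmf_degree_pmf:
  assumes "N > 0"
  shows "pmf (degree_pmf N G) k = real (num_degree N k G) / real N"
proof -
  have "{..<N} \<inter> vertex_degree N G -` {k} = {v \<in> {..<N}. vertex_degree N G v = k}"
    by auto
  then show ?thesis
    using assms
    by (simp add: degree_pmf_def pmf_map measure_pmf_of_set num_degree_def lessThan_empty_iff)
qed

lemma pgf_degree_pmf:
  assumes "N > 0"
  shows "pgf (degree_pmf N G) s = (\<Sum>v<N. s ^ vertex_degree N G v) / real N"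
  using assms by (simp add: pgf_def degree_pmf_def integral_pmf_of_set lessThan_empty_iff)

context hyperbolic_parameters
begin

lemma integral_pgf_degree_pmf_diff_square_le:
  assumes "N \<ge> 2" "s \<in> {0..1}"
  shows "(\<integral>G. (pgf (degree_pmf N G) s - l)\<^sup>2 \<partial>random_graph \<zeta> \<alpha> \<beta> N)
    \<le> 1 / real N
      + ((mean_avoidance \<zeta> \<alpha> \<beta> (R N) (1 - s) (N - 2))\<^sup>2
        + real N * mean_square_connection_prob \<zeta> \<alpha> \<beta> (R N))
      - 2 * l * mean_avoidance \<zeta> \<alpha> \<beta> (R N) (1 - s) (N - 1) + l\<^sup>2"
    (is "_ \<le> 1 / real N + ?b - 2 * l * ?a + l\<^sup>2")
proof -
  interpret prob_space "random_graph \<zeta> \<alpha> \<beta> N"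
    using assms by (intro prob_space_random_graph \<zeta>_pos \<alpha>_pos)
  have "expectation (\<lambda>G. ((\<Sum>v<N. s ^ vertex_degree N G v) / card {..<N} - l)\<^sup>2)
      \<le> 1 / card {..<N} + ?b - 2 * l * ?a + l\<^sup>2"
  proof (rule expectation_average_diff_square_le)
    show "0 \<le> ?b"
      unfolding mean_square_connection_prob_def
      by (intro add_nonneg_nonneg mult_nonneg_nonneg Bochner_Integration.integral_nonneg) auto
    show "expectation (\<lambda>G. s ^ vertex_degree N G v) = ?a" if "v \<in> {..<N}" for v
      using that assms \<zeta>_pos \<alpha>_pos by (intro integral_power_vertex_degree) auto
    show "expectation (\<lambda>G. s ^ vertex_degree N G u * s ^ vertex_degree N G v) \<le> ?b"
      if "u \<in> {..<N}" "v \<in> {..<N}" "u \<noteq> v" for u v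
      using that assms \<zeta>_pos \<alpha>_pos by (intro integral_power_vertex_degree_mult_le) auto
  qed (use assms in \<open>auto simp: lessThan_empty_iff power_le_one intro: measurable_random_graph\<close>)
  then show ?thesis
    using assms by (simp add: pgf_degree_pmf)
qed

lemma tendsto_integral_pgf_degree_pmf_diff_square:
  assumes "s \<in> {0..1}"
  defines "l \<equiv> \<integral>t. exp (- ((1 - s) * limit_intensity t)) \<partial>exponential_measure \<alpha>"
  shows "(\<lambda>N. \<integral>G. (pgf (degree_pmf N G) s - l)\<^sup>2 \<partial>random_graph \<zeta> \<alpha> \<beta> N) \<longlonglongrightarrow> 0"
proof (rule tendsto_sandwich[OF _ _ tendsto_const])
  let ?A = "\<lambda>j N. mean_avoidance \<zeta> \<alpha> \<beta> (R N) (1 - s) (N - j)"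
  let ?B = "\<lambda>N. real N * mean_square_connection_prob \<zeta> \<alpha> \<beta> (R N)"
  have lim_A: "?A j \<longlonglongrightarrow> l" for j
    unfolding l_def using assms(1) by (intro tendsto_mean_avoidance one_minus_in_unit_interval)
  have "(\<lambda>N. 1 / real N + ((?A 2 N)\<^sup>2 + ?B N) - 2 * l * ?A 1 N + l\<^sup>2)
      \<longlonglongrightarrow> 0 + (l\<^sup>2 + 0) - 2 * l * l + l\<^sup>2"
    by (intro tendsto_add tendsto_diff tendsto_power tendsto_mult[OF tendsto_const] lim_A
        tendsto_mult_mean_square_connection_prob lim_1_over_n tendsto_const)
  then show "(\<lambda>N. 1 / real N + ((?A 2 N)\<^sup>2 + ?B N) - 2 * l * ?A 1 N + l\<^sup>2) \<longlonglongrightarrow> 0"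
    by (simp add: power2_eq_square)
  show "\<forall>\<^sub>F N in sequentially. (\<integral>G. (pgf (degree_pmf N G) s - l)\<^sup>2 \<partial>random_graph \<zeta> \<alpha> \<beta> N)
      \<le> 1 / real N + ((?A 2 N)\<^sup>2 + ?B N) - 2 * l * ?A 1 N + l\<^sup>2"
    using eventually_ge_at_top[of 2]
    by eventually_elim (intro integral_pgf_degree_pmf_diff_square_le assms(1))
qed (auto intro!: always_eventually Bochner_Integration.integral_nonneg)

lemma eventually_finite_measure_random_graph:
  "\<forall>\<^sub>F N in sequentially. finite_measure (random_graph \<zeta> \<alpha> \<beta> N)"
  using eventually_ge_at_top[of 2]
  by eventually_elim (intro prob_space.finite_measure prob_space_random_graph \<zeta>_pos \<alpha>_pos)

lemma mixing_constant_pos: "mixing_constant \<zeta> \<alpha> \<beta> > 0"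
  unfolding mixing_constant_def using sin_pi_div_\<beta>_pos \<alpha>_pos \<beta>_gt_1 \<zeta>_less
  by (intro mult_pos_pos divide_pos_pos) auto

lemma limit_intensity_measurable [measurable]: "limit_intensity \<in> borel_measurable borel"
  unfolding limit_intensity_def[abs_def] by measurable

lemma limit_intensity_nonneg: "0 \<le> limit_intensity t"
  using mixing_constant_pos by (simp add: limit_intensity_def)

definition limit_degree_pmf :: "nat pmf" where
  "limit_degree_pmf = mixed_poisson_pmf (exponential_measure \<alpha>) limit_intensity"

lemma tendsto_in_probability_pgf_degree_pmf:
  assumes "s \<in> {0..1}"
  shows "tendsto_in_probability (random_graph \<zeta> \<alpha> \<beta>) (\<lambda>N G. pgf (degree_pmf N G) s)
    (pgf limit_degree_pmf s)"
proof -
  interpret prob_space "exponential_measure \<alpha>"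
    by (rule prob_space_exponential_density[OF \<alpha>_pos])
  have limit: "pgf limit_degree_pmf s
      = (\<integral>t. exp (- ((1 - s) * limit_intensity t)) \<partial>exponential_measure \<alpha>)"
    unfolding limit_degree_pmf_def using assms
    by (intro pgf_mixed_poisson_pmf limit_intensity_nonneg) auto
  have "integrable (random_graph \<zeta> \<alpha> \<beta> N)
      (\<lambda>G. (pgf (degree_pmf N G) s - pgf limit_degree_pmf s)\<^sup>2)" if "N \<ge> 2" for N
  proof (intro integrable_random_graph \<zeta>_pos \<alpha>_pos that)
    have "\<bar>pgf (degree_pmf N G) s - pgf limit_degree_pmf s\<bar> \<le> 1" for G
      using pgf_bounds[OF assms, of "degree_pmf N G"] pgf_bounds[OF assms, of limit_degree_pmf]
      by auto
    then show "(pgf (degree_pmf N G) s - pgf limit_degree_pmf s)\<^sup>2 \<in> {0..1}" for G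
      by (simp add: abs_square_le_1)
  qed
  then have "\<forall>\<^sub>F N in sequentially.
      integrable (random_graph \<zeta> \<alpha> \<beta> N) (\<lambda>G. (pgf (degree_pmf N G) s - pgf limit_degree_pmf s)\<^sup>2)"
    by (rule eventually_sequentiallyI)
  then show ?thesis
    using tendsto_integral_pgf_degree_pmf_diff_square[OF assms]
    by (intro tendsto_in_probability_if_mean_square eventually_finite_measure_random_graph
        measurable_random_graph) (simp_all add: limit)
qed

lemma mixed_poisson_prob_mixing_cdf:
  "mixed_poisson_prob (mixing_cdf \<zeta> \<alpha> \<beta>) k = pmf limit_degree_pmf k"
proof -
  interpret E: prob_space "exponential_measure \<alpha>"
    by (rule prob_space_exponential_density[OF \<alpha>_pos])
  let ?D = "distr (exponential_measure \<alpha>) borel limit_intensity"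
  interpret D: real_distribution ?D
    by (rule E.real_distribution_distr) simp
  have "cdf ?D = mixing_cdf \<zeta> \<alpha> \<beta>"
    using cdf_distr_exp_exponential[of \<alpha> "\<zeta> / 2" "mixing_constant \<zeta> \<alpha> \<beta>"]
      \<alpha>_pos \<zeta>_pos mixing_constant_pos
    by (simp add: fun_eq_iff mixing_cdf_def Let_def limit_intensity_def[abs_def] mult.commute)
  then have "mixed_poisson_prob (mixing_cdf \<zeta> \<alpha> \<beta>) k = (\<integral>t. poisson_weight t k \<partial>?D)"
    using D.interval_measure_cdf by (simp add: mixed_poisson_prob_def poisson_weight_def)
  also have "\<dots> = E.expectation (\<lambda>t. poisson_weight (limit_intensity t) k)"
    by (rule integral_distr) auto
  also have "\<dots> = pmf limit_degree_pmf k"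
    unfolding limit_degree_pmf_def
    by (rule E.pmf_mixed_poisson_pmf[symmetric]) (auto simp: limit_intensity_nonneg)
  finally show ?thesis .
qed

end

theorem theorem1p2:
  fixes \<zeta> \<alpha> \<beta> :: real and k :: nat
  assumes "0 < \<zeta>" and "\<zeta> < 2" and "\<alpha> > 0"
    and "\<beta> > 1" and "0 < \<zeta> / \<alpha>" and "\<zeta> / \<alpha> < 2"
  shows "tendsto_in_probability (random_graph \<zeta> \<alpha> \<beta>)
           (\<lambda>N G. real (num_degree N k G) / real N)
           (mixed_poisson_prob (mixing_cdf \<zeta> \<alpha> \<beta>) k)"
proof -
  interpret hyperbolic_parameters \<zeta> \<alpha> \<beta>
    by standard (use assms in \<open>auto simp: divide_less_eq\<close>)
  have "tendsto_in_probability (random_graph \<zeta> \<alpha> \<beta>) (\<lambda>N G. pmf (degree_pmf N G) k)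
      (pmf limit_degree_pmf k)"
    by (intro tendsto_in_probability_pmf_if_pgf eventually_finite_measure_random_graph
        measurable_random_graph tendsto_in_probability_pgf_degree_pmf)
  moreover have "\<forall>\<^sub>F N in sequentially. \<forall>G. pmf (degree_pmf N G) k
      = real (num_degree N k G) / real N"
    using eventually_gt_at_top[of 0] by eventually_elim (simp add: pmf_degree_pmf)
  ultimately show ?thesis
    unfolding mixed_poisson_prob_mixing_cdf by (simp only: tendsto_in_probability_cong)
qed

end
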